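(* Let $d\ge 3$ and $2\le r\le d-1$, and let $n_1,n_2,\ldots,n_r$ be integers with $n_i\ge d+1$ for all $1\le i\le r$. There exist $r$ neighborly $d$-polytopes $P_1,P_2,\ldots,P_r$ in $\mathbb{R}^d$, with $n_1,n_2,\ldots,n_r$ vertices, respectively, such that, for all integers $k$ with $0\le k\le \lfloor\frac{d+r-1}{2}\rfloor-r$, $$f_k(P_1+P_2+\cdots+P_r)=\sum_{\substack{1\le s_i\le n_i\\ s_1+\cdots+s_r=k+r}}\ \prod_{i=1}^r\binom{n_i}{s_i},$$ where the sum ranges over all $r$-tuples $(s_1,\ldots,s_r)$ of integers with $1\le s_i\le n_i$ for $1\le i\le r$ and $s_1+\cdots+s_r=k+r$.
   Context: A polytope is the convex hull of a finite set of points; a $d$-polytope is a polytope of dimension $d$. $f_k(P)$ denotes the number of $k$-dimensional faces of $P$. The Minkowski sum of sets is $A+B=\{a+b\mid a\in A, b\in B\}$. A $d$-polytope is called $m$-neighborly if every subset of its vertices of size at most $m$ defines a face (i.e., is the vertex set of a face) of it; a $d$-polytope is called neighborly if it is $\lfloor\frac{d}{2}\rfloor$-neighborly. *)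

theory Defs
  imports "HOL-Analysis.Analysis"
begin

definition d_polytope :: "nat \<Rightarrow> 'a::euclidean_space set \<Rightarrow> bool" where
  "d_polytope d P \<longleftrightarrow> polytope P \<and> aff_dim P = int d"

definition vertices :: "'a::real_vector set \<Rightarrow> 'a set" where
  "vertices P = {v. v extreme_point_of P}"

definition f_num :: "nat \<Rightarrow> 'a::euclidean_space set \<Rightarrow> nat" where
  "f_num k P = card {F. F face_of P \<and> aff_dim F = int k}"

(* The empty set is a face in the sense of face_of, so V = {} imposes no condition. *)
definition m_neighborly :: "nat \<Rightarrow> 'a::real_vector set \<Rightarrow> bool" where
  "m_neighborly m P \<longleftrightarrow>
     (\<forall>V. V \<subseteq> vertices P \<and> card V \<le> m \<longrightarrow> (\<exists>F. F face_of P \<and> vertices F = V))"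

definition neighborly_polytope :: "nat \<Rightarrow> 'a::euclidean_space set \<Rightarrow> bool" where
  "neighborly_polytope d P \<longleftrightarrow> d_polytope d P \<and> m_neighborly (d div 2) P"

end

theory Submission
  imports Defs
begin

text \<open>Faces of a Minkowski sum correspond to tuples of faces exposed by a common functional. So it
  suffices that every tuple of nonempty vertex sets \<open>S\<^sub>i\<close> with at most \<open>(d + r - 1) div 2\<close> elements in
  total is exposed by a common functional: chains of such tuples then force the exposed sums to have
  the expected dimension.

  With \<open>D = d - r + 1\<close>, place the vertices of the \<open>i\<close>-th polytope, with parameters in an interval of
  its own, on a curve whose \<open>i\<close>-th coordinate is \<open>t\<close>, whose last \<open>d - r\<close> coordinates are
  \<open>t^2, \<dots>, t^D\<close>, and whose other coordinates are \<open>z\<close> times the powers \<open>t^(D + 1), \<dots>, t^d\<close>. For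
  \<open>z \<noteq> 0\<close> this is a rescaled moment curve, so the polytope is cyclic. For \<open>z = 0\<close> a functional
  restricts to polynomials \<open>f\<^sub>i = a\<^sub>i + b\<^sub>i t + q(t)\<close> with a common \<open>q\<close> of degree at most \<open>D\<close>. Linear
  algebra yields such \<open>f\<^sub>i\<close>, not all zero, with double zeros on \<open>S\<^sub>i\<close>; by Rolle, any further zero
  would give the common second derivative \<open>q''\<close> too many roots, so up to a common sign all \<open>f\<^sub>i\<close> are
  positive off \<open>S\<^sub>i\<close>. The points of \<open>S\<^sub>i\<close> impose independent conditions, so exposure persists for
  small \<open>z > 0\<close>.\<close>

section \<open>Faces of Minkowski sums of polytopes\<close>

definition exposes :: "'a::real_inner \<Rightarrow> 'i set \<Rightarrow> ('i \<Rightarrow> 'a set) \<Rightarrow> ('i \<Rightarrow> 'a set) \<Rightarrow> bool" where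
  "exposes c I V S \<longleftrightarrow> (\<exists>h. \<forall>i\<in>I. \<forall>v\<in>V i. c \<bullet> v \<le> h i \<and> (c \<bullet> v = h i \<longleftrightarrow> v \<in> S i))"

lemma convex_hull_inner_le:
  assumes "\<And>v. v \<in> V \<Longrightarrow> c \<bullet> v \<le> b" "x \<in> convex hull V"
  shows "c \<bullet> x \<le> b"
proof -
  have "convex hull V \<subseteq> {x. c \<bullet> x \<le> b}"
    by (rule hull_minimal) (auto simp: assms convex_halfspace_le)
  then show ?thesis using assms(2) by auto
qed

lemma convex_hull_inner_eq:
  assumes "\<And>v. v \<in> S \<Longrightarrow> c \<bullet> v = b" "x \<in> convex hull S"
  shows "c \<bullet> x = b"
proof -
  have "convex hull S \<subseteq> {x. c \<bullet> x = b}"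
    by (rule hull_minimal) (auto simp: assms convex_hyperplane)
  then show ?thesis using assms(2) by auto
qed

text \<open>In a convex combination lying on the hyperplane, the weighted gaps
  \<open>b - c \<bullet> v\<close> are nonnegative and sum to zero, so no weight falls outside
  \<open>S\<close>.\<close>

lemma convex_hull_max_face:
  assumes fin: "finite V" and le: "\<And>v. v \<in> V \<Longrightarrow> c \<bullet> v \<le> b"
    and eq: "\<And>v. v \<in> V \<Longrightarrow> c \<bullet> v = b \<longleftrightarrow> v \<in> S" and "S \<subseteq> V"
  shows "convex hull V \<inter> {x. c \<bullet> x = b} = convex hull S"
proof (rule equalityI)
  show "convex hull S \<subseteq> convex hull V \<inter> {x. c \<bullet> x = b}"
    using hull_mono[OF \<open>S \<subseteq> V\<close>] convex_hull_inner_eq[of S c b] eq \<open>S \<subseteq> V\<close> by blast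
next
  show "convex hull V \<inter> {x. c \<bullet> x = b} \<subseteq> convex hull S"
  proof (rule subsetI)
    fix x assume "x \<in> convex hull V \<inter> {x. c \<bullet> x = b}"
    then have "x \<in> convex hull V" and x: "c \<bullet> x = b" by auto
    then obtain u where u: "\<And>v. v \<in> V \<Longrightarrow> 0 \<le> u v" "sum u V = 1" "(\<Sum>v\<in>V. u v *\<^sub>R v) = x"
      by (auto simp: convex_hull_finite[OF fin])
    have "(\<Sum>v\<in>V. u v * (b - c \<bullet> v)) = b * sum u V - c \<bullet> (\<Sum>v\<in>V. u v *\<^sub>R v)"
      by (simp add: algebra_simps sum_subtractf sum_distrib_left inner_sum_right)
    also have "\<dots> = 0" using u x by simp
    finally have "\<forall>v\<in>V. u v * (b - c \<bullet> v) = 0"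
      using u le by (subst (asm) sum_nonneg_eq_0_iff) (auto simp: fin)
    then have zero: "\<forall>v\<in>V - S. u v = 0" using eq by auto
    have "sum u S = 1"
      using sum.mono_neutral_left[of V S u] fin zero \<open>S \<subseteq> V\<close> u by simp
    moreover have "(\<Sum>v\<in>S. u v *\<^sub>R v) = x"
      using sum.mono_neutral_left[of V S "\<lambda>v. u v *\<^sub>R v"] fin zero \<open>S \<subseteq> V\<close> u by simp
    ultimately show "x \<in> convex hull S"
      using u \<open>S \<subseteq> V\<close> finite_subset[OF \<open>S \<subseteq> V\<close> fin] by (auto simp: convex_hull_finite)
  qed
qed

lemma sum_hulls_le:
  assumes "finite I" "\<And>i v. i \<in> I \<Longrightarrow> v \<in> V i \<Longrightarrow> c \<bullet> v \<le> h i"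
    and "x \<in> (\<Sum>i\<in>I. convex hull V i)"
  shows "c \<bullet> x \<le> sum h I"
proof -
  obtain s where s: "x = sum s I" "\<forall>i\<in>I. s i \<in> convex hull V i"
    using assms by (auto simp: set_sum_alt)
  have "c \<bullet> s i \<le> h i" if "i \<in> I" for i
    using convex_hull_inner_le[of "V i" c "h i" "s i"] s assms that by blast
  then show ?thesis using s by (simp add: inner_sum_right sum_mono)
qed

text \<open>The gaps \<open>h i - c \<bullet> s i\<close> are nonnegative, so a sum attains
  \<open>sum h I\<close> only if every summand attains its own bound.\<close>

lemma sum_hulls_max_face:
  assumes "finite I" and fin: "\<forall>i\<in>I. finite (V i)"
    and le: "\<forall>i\<in>I. \<forall>v\<in>V i. c \<bullet> v \<le> h i \<and> (c \<bullet> v = h i \<longleftrightarrow> v \<in> S i)"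
    and sub: "\<forall>i\<in>I. S i \<subseteq> V i"
  shows "(\<Sum>i\<in>I. convex hull V i) \<inter> {x. c \<bullet> x = sum h I} = (\<Sum>i\<in>I. convex hull S i)"
proof -
  have face: "convex hull V i \<inter> {x. c \<bullet> x = h i} = convex hull S i" if "i \<in> I" for i
    using convex_hull_max_face[of "V i" c "h i" "S i"] fin le sub that by blast
  have "(\<forall>i\<in>I. c \<bullet> s i = h i) \<longleftrightarrow> c \<bullet> sum s I = sum h I"
    if "\<forall>i\<in>I. s i \<in> convex hull V i" for s
  proof
    assume "c \<bullet> sum s I = sum h I"
    then have "(\<Sum>i\<in>I. h i - c \<bullet> s i) = 0" by (simp add: inner_sum_right sum_subtractf)
    moreover have "0 \<le> h i - c \<bullet> s i" if "i \<in> I" for i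
      using convex_hull_inner_le[of "V i" c "h i" "s i"] le that \<open>\<forall>i\<in>I. s i \<in> _\<close> by force
    ultimately show "\<forall>i\<in>I. c \<bullet> s i = h i"
      by (subst (asm) sum_nonneg_eq_0_iff) (auto simp: \<open>finite I\<close>)
  qed (simp add: inner_sum_right)
  note max = this
  show ?thesis
  proof (intro set_eqI iffI)
    fix x assume "x \<in> (\<Sum>i\<in>I. convex hull V i) \<inter> {x. c \<bullet> x = sum h I}"
    then obtain s where s: "x = sum s I" "\<forall>i\<in>I. s i \<in> convex hull V i" "c \<bullet> x = sum h I"
      by (auto simp: set_sum_alt[OF \<open>finite I\<close>])
    then have "\<forall>i\<in>I. s i \<in> convex hull S i" using max[OF s(2)] face by blast
    then show "x \<in> (\<Sum>i\<in>I. convex hull S i)"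
      using s(1) unfolding set_sum_alt[OF \<open>finite I\<close>] by blast
  next
    fix x assume "x \<in> (\<Sum>i\<in>I. convex hull S i)"
    then obtain s where s: "x = sum s I" "\<forall>i\<in>I. s i \<in> convex hull S i"
      by (auto simp: set_sum_alt[OF \<open>finite I\<close>])
    then have "\<forall>i\<in>I. s i \<in> convex hull V i" "\<forall>i\<in>I. c \<bullet> s i = h i" using face by blast+
    then show "x \<in> (\<Sum>i\<in>I. convex hull V i) \<inter> {x. c \<bullet> x = sum h I}"
      using s(1) max[of s] unfolding set_sum_alt[OF \<open>finite I\<close>] by blast
  qed
qed

text \<open>Relative to base points \<open>b i\<close>, the sum lies in a translate of the span of
  differences, and each \<open>S i\<close> contributes at most \<open>card (S i) - 1\<close> of
  them.\<close>

lemma aff_dim_sum_hulls_le: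
  fixes S :: "'i \<Rightarrow> 'a::euclidean_space set"
  assumes "finite I" and fin: "\<forall>i\<in>I. finite (S i)" and ne: "\<forall>i\<in>I. S i \<noteq> {}"
  shows "aff_dim (\<Sum>i\<in>I. convex hull S i) \<le> int (\<Sum>i\<in>I. card (S i)) - int (card I)"
proof -
  obtain b where b: "\<forall>i\<in>I. b i \<in> S i"
    using that[of "\<lambda>i. SOME v. v \<in> S i"] ne by (simp add: some_in_eq)
  define W where "W = (\<Union>i\<in>I. (\<lambda>s. s - b i) ` (S i - {b i}))"
  have fW: "finite W" unfolding W_def using assms by auto
  have "card W \<le> (\<Sum>i\<in>I. card ((\<lambda>s. s - b i) ` (S i - {b i})))"
    unfolding W_def by (rule card_UN_le) fact
  also have "\<dots> \<le> (\<Sum>i\<in>I. card (S i) - 1)"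
    by (rule sum_mono) (metis b card_Diff_singleton card_image_le fin finite_Diff)
  finally have cW: "int (card W) \<le> int (\<Sum>i\<in>I. card (S i) - 1)" by linarith
  have pos: "1 \<le> card (S i)" if "i \<in> I" for i
    using fin ne that by (simp add: Suc_leI card_gt_0_iff)
  have "int (\<Sum>i\<in>I. card (S i) - 1) = (\<Sum>i\<in>I. int (card (S i)) - 1)"
    using pos by (auto simp: of_nat_diff intro!: sum.cong)
  then have eq: "int (\<Sum>i\<in>I. card (S i) - 1) = int (\<Sum>i\<in>I. card (S i)) - int (card I)"
    by (simp add: sum_subtractf)
  have "convex hull S i \<subseteq> (+) (b i) ` span W" if i: "i \<in> I" for i
  proof (rule hull_minimal)
    have "s - b i \<in> span W" if "s \<in> S i" for s
    proof (cases "s = b i")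
      case False
      then have "s - b i \<in> W" unfolding W_def using i that by auto
      then show ?thesis by (rule span_base)
    qed (simp add: span_zero)
    then show "S i \<subseteq> (+) (b i) ` span W"
      by (force simp: image_iff)
    show "convex ((+) (b i) ` span W)"
      using subspace_imp_convex[of "span W"] by (simp add: convex_translation)
  qed
  then have *: "s - b i \<in> span W" if "i \<in> I" "s \<in> convex hull S i" for s i
    using that by fastforce
  have "(\<Sum>i\<in>I. convex hull S i) \<subseteq> (+) (sum b I) ` span W"
  proof
    fix x assume "x \<in> (\<Sum>i\<in>I. convex hull S i)"
    then obtain s where s: "x = sum s I" "\<forall>i\<in>I. s i \<in> convex hull S i"
      using assms by (auto simp: set_sum_alt)
    then have "(\<Sum>i\<in>I. s i - b i) \<in> span W" by (intro span_sum) (use * in auto)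
    then have "x - sum b I \<in> span W" using s by (simp add: sum_subtractf)
    then show "x \<in> (+) (sum b I) ` span W" by (force simp: image_iff)
  qed
  then have "aff_dim (\<Sum>i\<in>I. convex hull S i) \<le> aff_dim ((+) (sum b I) ` span W)"
    by (rule aff_dim_subset)
  also have "\<dots> = int (dim W)"
    by (simp add: aff_dim_translation_eq aff_dim_subspace)
  also have "\<dots> \<le> int (card W)" using dim_le_card[of W W] fW by (simp add: span_superset)
  finally show ?thesis using cW eq by linarith
qed

lemma sum_hulls_mono:
  assumes "finite I" "\<forall>i\<in>I. S i \<subseteq> S' i"
  shows "(\<Sum>i\<in>I. convex hull S i) \<subseteq> (\<Sum>i\<in>I. convex hull S' i)"
proof -
  have "convex hull S i \<subseteq> convex hull S' i" if "i \<in> I" for i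
    using assms(2) that by (intro hull_mono) auto
  then show ?thesis unfolding set_sum_alt[OF assms(1)] by auto
qed

lemma sum_hulls_ne:
  assumes "finite I" "\<forall>i\<in>I. S i \<noteq> {}"
  shows "(\<Sum>i\<in>I. convex hull S i) \<noteq> {}"
proof -
  obtain b where "\<forall>i\<in>I. b i \<in> S i"
    using that[of "\<lambda>i. SOME v. v \<in> S i"] assms by (simp add: some_in_eq)
  then have "sum b I \<in> (\<Sum>i\<in>I. convex hull S i)"
    unfolding set_sum_alt[OF assms(1)] by (blast intro: hull_inc)
  then show ?thesis by auto
qed

text \<open>A point of \<open>S i\<close>, completed arbitrarily in the other sets, gives a point of
  the larger sum and so attains the total bound for \<open>c\<close>; then each summand attains its
  own bound. Hence an exposed tuple can be read off from its sum.\<close>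

lemma exposed_sum_hulls_subset:
  assumes "finite I" and exp: "exposes c I V S'"
    and sub: "\<forall>i\<in>I. S i \<subseteq> V i" "\<forall>i\<in>I. S' i \<subseteq> V i"
    and ne: "\<forall>i\<in>I. S i \<noteq> {}"
    and le: "(\<Sum>i\<in>I. convex hull S i) \<subseteq> (\<Sum>i\<in>I. convex hull S' i)" and i: "i \<in> I"
  shows "S i \<subseteq> S' i"
proof
  fix v assume v: "v \<in> S i"
  obtain h where h: "\<forall>i\<in>I. \<forall>v\<in>V i. c \<bullet> v \<le> h i \<and> (c \<bullet> v = h i \<longleftrightarrow> v \<in> S' i)"
    using exp unfolding exposes_def by blast
  obtain b0 where b0: "\<forall>i\<in>I. b0 i \<in> S i"
    using that[of "\<lambda>i. SOME v. v \<in> S i"] ne by (simp add: some_in_eq)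
  define b where "b = b0(i := v)"
  have b: "b j \<in> S j" if "j \<in> I" for j using b0 v that by (auto simp: b_def)
  then have "sum b I \<in> (\<Sum>i\<in>I. convex hull S i)"
    unfolding set_sum_alt[OF assms(1)] by (blast intro: hull_inc)
  then have "sum b I \<in> (\<Sum>i\<in>I. convex hull S' i)" using le by auto
  then obtain s where s: "sum b I = sum s I" "\<forall>i\<in>I. s i \<in> convex hull S' i"
    using assms by (auto simp: set_sum_alt)
  have "c \<bullet> s j = h j" if "j \<in> I" for j
    using convex_hull_inner_eq[of "S' j" c "h j" "s j"] s h sub that by blast
  then have "c \<bullet> sum b I = sum h I" using s(1) by (simp add: inner_sum_right)
  then have "(\<Sum>j\<in>I. h j - c \<bullet> b j) = 0" by (simp add: inner_sum_right sum_subtractf)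
  moreover have "0 \<le> h j - c \<bullet> b j" if "j \<in> I" for j
    using h b sub that by (metis diff_ge_0_iff_ge subsetD)
  ultimately have "\<forall>j\<in>I. h j - c \<bullet> b j = 0"
    by (subst (asm) sum_nonneg_eq_0_iff) (auto simp: \<open>finite I\<close>)
  then have "c \<bullet> v = h i" using i by (auto simp: b_def)
  then show "v \<in> S' i" using h sub i v by blast
qed

lemma exposed_sum_hulls_face:
  assumes "finite I" and fin: "\<forall>i\<in>I. finite (V i)" and exp: "exposes c I V S"
    and sub: "\<forall>i\<in>I. S i \<subseteq> V i"
  shows "(\<Sum>i\<in>I. convex hull S i) face_of (\<Sum>i\<in>I. convex hull V i)"
proof -
  obtain h where h: "\<forall>i\<in>I. \<forall>v\<in>V i. c \<bullet> v \<le> h i \<and> (c \<bullet> v = h i \<longleftrightarrow> v \<in> S i)"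
    using exp unfolding exposes_def by blast
  have "convex (\<Sum>i\<in>I. convex hull V i)"
    by (simp flip: convex_hull_set_sum)
  moreover have "c \<bullet> x \<le> sum h I" if "x \<in> (\<Sum>i\<in>I. convex hull V i)" for x
    using sum_hulls_le[OF assms(1), of V c h] h that by blast
  ultimately have "(\<Sum>i\<in>I. convex hull V i) \<inter> {x. c \<bullet> x = sum h I} face_of (\<Sum>i\<in>I. convex hull V i)"
    by (rule face_of_Int_supporting_hyperplane_le)
  then show ?thesis
    using sum_hulls_max_face[OF assms(1), of V c h S] h fin sub by auto
qed

text \<open>Faces of a polytope are exposed, and a functional is maximised on a sum by maximising it
  on each \<open>V i\<close> separately; the maximisers form \<open>S i\<close>.\<close>

lemma sum_hulls_face_exposed:
  fixes V :: "'i \<Rightarrow> 'a::euclidean_space set"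
  assumes "finite I" and fin: "\<forall>i\<in>I. finite (V i)"
    and F: "F face_of (\<Sum>i\<in>I. convex hull V i)" "F \<noteq> {}"
  obtains c S where "exposes c I V S" "\<forall>i\<in>I. S i \<subseteq> V i" "\<forall>i\<in>I. S i \<noteq> {}"
    "F = (\<Sum>i\<in>I. convex hull S i)"
proof -
  let ?P = "\<Sum>i\<in>I. convex hull V i"
  have "polytope ?P"
    using finite_set_sum[of I V] fin unfolding polytope_def convex_hull_set_sum[symmetric] by blast
  then have "F exposed_face_of ?P"
    using F exposed_face_of_polyhedron polytope_imp_polyhedron by blast
  then obtain c b where cb: "?P \<subseteq> {x. c \<bullet> x \<le> b}" "F = ?P \<inter> {x. c \<bullet> x = b}"
    unfolding exposed_face_of_def by blast
  then obtain x where x: "x \<in> ?P" "c \<bullet> x = b" using F by blast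
  then have neV: "V i \<noteq> {}" if "i \<in> I" for i
    using that unfolding set_sum_alt[OF assms(1)] by fastforce
  define h where "h = (\<lambda>i. Max ((\<bullet>) c ` V i))"
  define S where "S = (\<lambda>i. {v \<in> V i. c \<bullet> v = h i})"
  have le: "c \<bullet> v \<le> h i" if "i \<in> I" "v \<in> V i" for i v
    unfolding h_def using fin that by (intro Max_ge) auto
  have ne: "\<forall>i\<in>I. S i \<noteq> {}"
  proof
    fix i assume i: "i \<in> I"
    have "h i \<in> (\<bullet>) c ` V i" unfolding h_def using fin neV i by (intro Max_in) auto
    then show "S i \<noteq> {}" unfolding S_def by auto
  qed
  have exp: "exposes c I V S"
    unfolding exposes_def S_def using le by blast
  have eq: "?P \<inter> {x. c \<bullet> x = sum h I} = (\<Sum>i\<in>I. convex hull S i)"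
    using le by (intro sum_hulls_max_face[OF assms(1) fin]) (auto simp: S_def)
  \<comment> \<open>Both \<open>b\<close> and \<open>sum h I\<close> are upper bounds of
    \<open>c\<close> attained on \<open>?P\<close>, so they agree.\<close>
  have "b \<le> sum h I" using sum_hulls_le[OF assms(1), of V c h x] le x by auto
  moreover have "sum h I \<le> b"
  proof -
    obtain y where "y \<in> (\<Sum>i\<in>I. convex hull S i)"
      using sum_hulls_ne[OF assms(1) ne] by auto
    then have "y \<in> ?P" "c \<bullet> y = sum h I" unfolding eq[symmetric] by auto
    then show ?thesis using cb(1) by auto
  qed
  ultimately have "F = (\<Sum>i\<in>I. convex hull S i)" using cb eq by simp
  then show thesis using that[OF exp _ ne] by (auto simp: S_def)
qed

text \<open>Removing one point from a set with at least two leaves an exposed tuple with a strictly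
  smaller face, so each removal lowers the dimension by at least one. The chain ends with
  singletons, whose sum is nonempty. Together with \<open>aff_dim_sum_hulls_le\<close> this fixes
  the dimension.\<close>

lemma sum_hulls_dim_ge:
  fixes V :: "'i \<Rightarrow> 'a::euclidean_space set"
  assumes "finite I" and fin: "\<forall>i\<in>I. finite (V i)"
    and all: "\<And>S. (\<forall>i\<in>I. S i \<noteq> {} \<and> S i \<subseteq> V i) \<Longrightarrow> (\<Sum>i\<in>I. card (S i)) \<le> M \<Longrightarrow> \<exists>c. exposes c I V S"
  shows "(\<forall>i\<in>I. S i \<noteq> {} \<and> S i \<subseteq> V i) \<Longrightarrow> (\<Sum>i\<in>I. card (S i)) \<le> M \<Longrightarrow>
    int (\<Sum>i\<in>I. card (S i)) - int (card I) \<le> aff_dim (\<Sum>i\<in>I. convex hull S i)"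
proof (induction "\<Sum>i\<in>I. card (S i)" arbitrary: S rule: less_induct)
  case less
  have finS: "finite (S i)" if "i \<in> I" for i using less.prems fin that finite_subset by metis
  show ?case
  proof (cases "\<forall>i\<in>I. card (S i) \<le> 1")
    case True
    then have "(\<Sum>i\<in>I. card (S i)) \<le> (\<Sum>i\<in>I. 1)" by (intro sum_mono) auto
    then have "int (\<Sum>i\<in>I. card (S i)) \<le> int (card I)"
      unfolding of_nat_le_iff by simp
    moreover have "aff_dim (\<Sum>i\<in>I. convex hull S i) \<ge> 0"
      using sum_hulls_ne[OF assms(1), of S] less.prems(1) aff_dim_negative_iff not_less by metis
    ultimately show ?thesis by linarith
  next
    case False
    then obtain i where i: "i \<in> I" "2 \<le> card (S i)" by force
    then obtain a where a: "a \<in> S i" by fastforce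
    define S' where "S' = S(i := S i - {a})"
    have S'i: "card (S' i) = card (S i) - 1" using a i finS by (simp add: S'_def)
    have "S' i \<noteq> {}" using S'i i(2) by fastforce
    have ne': "\<forall>j\<in>I. S' j \<noteq> {} \<and> S' j \<subseteq> V j"
    proof
      fix j assume "j \<in> I"
      with less.prems(1) have "S j \<noteq> {} \<and> S j \<subseteq> V j" by blast
      then show "S' j \<noteq> {} \<and> S' j \<subseteq> V j"
        using \<open>S' i \<noteq> {}\<close> by (cases "j = i") (auto simp: S'_def)
    qed
    have "(\<Sum>i\<in>I. card (S i)) = card (S i) + (\<Sum>j\<in>I - {i}. card (S j))"
      "(\<Sum>i\<in>I. card (S' i)) = card (S' i) + (\<Sum>j\<in>I - {i}. card (S' j))"
      by (auto intro!: sum.remove simp: assms i)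
    moreover have "(\<Sum>j\<in>I - {i}. card (S' j)) = (\<Sum>j\<in>I - {i}. card (S j))"
      by (rule sum.cong) (auto simp: S'_def)
    ultimately have card: "(\<Sum>i\<in>I. card (S i)) = Suc (\<Sum>i\<in>I. card (S' i))"
      using S'i i by linarith
    then have IH: "int (\<Sum>i\<in>I. card (S' i)) - int (card I) \<le> aff_dim (\<Sum>i\<in>I. convex hull S' i)"
      using less.hyps[of S'] ne' less.prems by auto
    obtain c where c: "exposes c I V S'" using all[of S'] ne' card less.prems by auto
    obtain c' where c': "exposes c' I V S" using all[of S] less.prems by auto
    have S'S: "\<forall>j\<in>I. S' j \<subseteq> S j" by (auto simp: S'_def)
    have sub: "(\<Sum>i\<in>I. convex hull S' i) \<subseteq> (\<Sum>i\<in>I. convex hull S i)"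
      by (rule sum_hulls_mono[OF assms(1) S'S])
    have "(\<Sum>i\<in>I. convex hull S i) face_of (\<Sum>i\<in>I. convex hull V i)"
      using exposed_sum_hulls_face[OF assms(1) fin c'] less.prems by auto
    moreover have "(\<Sum>i\<in>I. convex hull S' i) face_of (\<Sum>i\<in>I. convex hull V i)"
      using exposed_sum_hulls_face[OF assms(1) fin c] ne' by auto
    ultimately have "(\<Sum>i\<in>I. convex hull S' i) face_of (\<Sum>i\<in>I. convex hull S i)"
      using sub face_of_subset face_of_imp_subset by metis
    moreover have "(\<Sum>i\<in>I. convex hull S' i) \<noteq> (\<Sum>i\<in>I. convex hull S i)"
    proof
      assume "(\<Sum>i\<in>I. convex hull S' i) = (\<Sum>i\<in>I. convex hull S i)"
      then have "S i \<subseteq> S' i"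
        using exposed_sum_hulls_subset[OF assms(1) c, of S i] less.prems ne' i by auto
      then show False using a by (auto simp: S'_def)
    qed
    moreover have "convex (\<Sum>i\<in>I. convex hull S i)"
      by (simp flip: convex_hull_set_sum)
    ultimately have "aff_dim (\<Sum>i\<in>I. convex hull S' i) < aff_dim (\<Sum>i\<in>I. convex hull S i)"
      by (intro face_of_aff_dim_lt)
    then show ?thesis using IH card by linarith
  qed
qed

text \<open>Trims a tuple to a prescribed total without emptying any set. This is needed because a
  face may come from a tuple too large for the exposure hypothesis of the face count.\<close>

lemma exists_nonempty_subfamily:
  assumes "finite I" and "\<forall>i\<in>I. finite (S i) \<and> S i \<noteq> {}"
    and "card I \<le> m" "m \<le> (\<Sum>i\<in>I. card (S i))"
  obtains T where "\<forall>i\<in>I. T i \<noteq> {} \<and> T i \<subseteq> S i" "(\<Sum>i\<in>I. card (T i)) = m"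
proof -
  have "\<exists>T. (\<forall>i\<in>I. T i \<noteq> {} \<and> T i \<subseteq> S i) \<and> (\<Sum>i\<in>I. card (T i)) = m"
    using assms
  proof (induction arbitrary: m rule: finite_induct)
    case (insert x I)
    have x: "1 \<le> card (S x)" using insert by (simp add: Suc_leI card_gt_0_iff)
    have "(\<Sum>i\<in>I. 1) \<le> (\<Sum>i\<in>I. card (S i))"
      using insert by (intro sum_mono) (auto simp: Suc_leI card_gt_0_iff)
    then have I: "card I \<le> (\<Sum>i\<in>I. card (S i))" by simp
    \<comment> \<open>As many points as possible are taken from \<open>S x\<close> while one is
      reserved for each index in \<open>I\<close>.\<close>
    define a where "a = min (card (S x)) (m - card I)"
    have a: "1 \<le> a" "a \<le> card (S x)" "card I \<le> m - a" "m - a \<le> (\<Sum>i\<in>I. card (S i))" "a \<le> m"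
      using insert x I by (auto simp: a_def)
    then obtain T where T: "\<forall>i\<in>I. T i \<noteq> {} \<and> T i \<subseteq> S i" "(\<Sum>i\<in>I. card (T i)) = m - a"
      using insert.IH[of "m - a"] insert.prems by auto
    obtain B where B: "B \<subseteq> S x" "card B = a" using obtain_subset_with_card_n[OF a(2)] by auto
    have "(\<Sum>i\<in>I. card ((T(x := B)) i)) = (\<Sum>i\<in>I. card (T i))"
      using insert by (intro sum.cong) auto
    then show ?case
      using T B a insert.hyps by (intro exI[of _ "T(x := B)"]) auto
  qed auto
  then show thesis using that by blast
qed

text \<open>Tuples with total at most \<open>M\<close> are exposed, so they give faces whose
  dimension is the total minus \<open>card I\<close>, and different tuples give different faces.
  Conversely, a \<open>k\<close>-face comes from an exposed tuple, which can be trimmed to total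
  \<open>k + card I\<close>.\<close>

theorem f_num_sum_hulls:
  fixes V :: "'i \<Rightarrow> 'a::euclidean_space set"
  assumes "finite I" and fin: "\<forall>i\<in>I. finite (V i)"
    and all: "\<And>S. (\<forall>i\<in>I. S i \<noteq> {} \<and> S i \<subseteq> V i) \<Longrightarrow> (\<Sum>i\<in>I. card (S i)) \<le> M \<Longrightarrow> \<exists>c. exposes c I V S"
    and k: "k + card I \<le> M"
  shows "f_num k (\<Sum>i\<in>I. convex hull V i) =
    card {S \<in> (\<Pi>\<^sub>E i\<in>I. Pow (V i) - {{}}). (\<Sum>i\<in>I. card (S i)) = k + card I}" (is "_ = card ?X")
proof -
  let ?P = "\<Sum>i\<in>I. convex hull V i" and ?f = "\<lambda>S. \<Sum>i\<in>I. convex hull S i"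
  have X: "\<forall>i\<in>I. S i \<noteq> {} \<and> S i \<subseteq> V i" if "S \<in> ?X" for S
    using that by (auto simp: PiE_def Pi_def)
  have dim: "aff_dim (?f S) = int (\<Sum>i\<in>I. card (S i)) - int (card I)"
    if "\<forall>i\<in>I. S i \<noteq> {} \<and> S i \<subseteq> V i" "(\<Sum>i\<in>I. card (S i)) \<le> M" for S
    using sum_hulls_dim_ge[OF assms(1) fin all that] aff_dim_sum_hulls_le[OF assms(1), of S] that fin
    by (meson antisym finite_subset)
  have face: "?f S face_of ?P"
    if S: "\<forall>i\<in>I. S i \<noteq> {} \<and> S i \<subseteq> V i" "(\<Sum>i\<in>I. card (S i)) \<le> M" for S
  proof -
    obtain c where "exposes c I V S" using all[OF S] by blast
    then show ?thesis using exposed_sum_hulls_face[OF assms(1) fin, of c S] S(1) by blast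
  qed
  have inj: "inj_on ?f ?X"
  proof (rule inj_onI)
    fix S T assume S: "S \<in> ?X" and T: "T \<in> ?X" and eq: "?f S = ?f T"
    obtain c c' where "exposes c I V S" "exposes c' I V T"
      using all[of S] all[of T] X[OF S] X[OF T] S T k by auto
    then have "S i = T i" if "i \<in> I" for i
      using exposed_sum_hulls_subset[OF assms(1), of c V S T i] X[OF S] X[OF T] that eq
        exposed_sum_hulls_subset[OF assms(1), of c' V T S i] by blast
    then show "S = T" using S T by (intro PiE_ext[of S I _ T]) simp_all
  qed
  have "{F. F face_of ?P \<and> aff_dim F = int k} = ?f ` ?X"
  proof (intro set_eqI iffI)
    fix F assume "F \<in> ?f ` ?X"
    then obtain S where S: "S \<in> ?X" "F = ?f S" by auto
    then show "F \<in> {F. F face_of ?P \<and> aff_dim F = int k}"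
      using dim[OF X[OF S(1)]] face[OF X[OF S(1)]] k by auto
  next
    fix F assume "F \<in> {F. F face_of ?P \<and> aff_dim F = int k}"
    then have F: "F face_of ?P" "aff_dim F = int k" by auto
    then have "F \<noteq> {}" by auto
    then obtain c S where cS: "exposes c I V S" "\<forall>i\<in>I. S i \<subseteq> V i" "\<forall>i\<in>I. S i \<noteq> {}"
      "F = ?f S" using sum_hulls_face_exposed[OF assms(1) fin F(1)] by metis
    have finS: "finite (S i)" if "i \<in> I" for i using cS(2) fin that finite_subset by metis
    have "aff_dim (?f S) \<le> int (\<Sum>i\<in>I. card (S i)) - int (card I)"
      by (rule aff_dim_sum_hulls_le[OF assms(1)]) (use finS cS(3) in auto)
    \<comment> \<open>The tuple exposing \<open>F\<close> may have total above \<open>M\<close>. A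
      trimmed tuple spans a face of \<open>F\<close> of the same dimension, which must be
      \<open>F\<close> itself.\<close>
    then have "k + card I \<le> (\<Sum>i\<in>I. card (S i))"
      using F(2) unfolding cS(4) by linarith
    then obtain T where T: "\<forall>i\<in>I. T i \<noteq> {} \<and> T i \<subseteq> S i" "(\<Sum>i\<in>I. card (T i)) = k + card I"
      using exists_nonempty_subfamily[OF assms(1), of S "k + card I"] finS cS by (metis le_add2)
    have TV: "\<forall>i\<in>I. T i \<noteq> {} \<and> T i \<subseteq> V i" using T cS by blast
    have "?f T \<subseteq> F" using sum_hulls_mono[OF assms(1), of T S] T cS by blast
    then have "?f T face_of F"
      using face[OF TV] T k F(1) face_of_subset face_of_imp_subset by (metis order_refl)
    moreover have "aff_dim (?f T) = aff_dim F" using dim[OF TV] T k F by auto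
    moreover have "convex F" using F(1) face_of_imp_convex by blast
    ultimately have FT: "F = ?f T" using face_of_aff_dim_lt by fastforce
    define T' where "T' = restrict T I"
    have "T' \<in> ?X" using T TV by (auto simp: T'_def)
    moreover have "F = ?f T'" using FT by (simp add: T'_def)
    ultimately show "F \<in> ?f ` ?X" by blast
  qed
  then show ?thesis unfolding f_num_def using card_image[OF inj] by simp
qed

section \<open>Counting tuples of nonempty subsets by their sizes\<close>

lemma card_nonempty_subfamilies:
  assumes "finite I" and fin: "\<forall>i\<in>I. finite (V i)"
  shows "card {S \<in> (\<Pi>\<^sub>E i\<in>I. Pow (V i) - {{}}). (\<Sum>i\<in>I. card (S i)) = m} =
    (\<Sum>s \<in> {s \<in> (\<Pi>\<^sub>E i\<in>I. {1..card (V i)}). (\<Sum>i\<in>I. s i) = m}. \<Prod>i\<in>I. card (V i) choose s i)"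
    (is "card ?X = sum _ ?Y")
proof -
  let ?B = "\<lambda>s. \<Pi>\<^sub>E i\<in>I. {B. B \<subseteq> V i \<and> card B = s i}"
  have "?X = (\<Union>s\<in>?Y. ?B s)"
  proof (intro set_eqI iffI)
    fix S assume S: "S \<in> ?X"
    define s where "s = (\<lambda>i\<in>I. card (S i))"
    have "card (S i) \<in> {1..card (V i)}" if "i \<in> I" for i
    proof -
      have "S i \<in> Pow (V i) - {{}}" using S that by (intro PiE_mem[of S I]) auto
      then have "S i \<subseteq> V i" "S i \<noteq> {}" "finite (V i)" using fin that by auto
      then show ?thesis by (simp add: card_mono Suc_le_eq card_gt_0_iff finite_subset)
    qed
    then have "s \<in> ?Y" "S \<in> ?B s" using S by (auto simp: s_def PiE_def Pi_def)
    then show "S \<in> (\<Union>s\<in>?Y. ?B s)" by blast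
  next
    fix S assume "S \<in> (\<Union>s\<in>?Y. ?B s)"
    then obtain s where s: "s \<in> ?Y" "S \<in> ?B s" by auto
    have "S i \<in> Pow (V i) - {{}} \<and> card (S i) = s i" if "i \<in> I" for i
      using PiE_mem[OF s(2) that] PiE_mem[of s I "\<lambda>i. {1..card (V i)}" i] s(1) that by auto
    then show "S \<in> ?X" using s by (auto simp: PiE_def Pi_def)
  qed
  moreover have "card (\<Union>s\<in>?Y. ?B s) = (\<Sum>s\<in>?Y. card (?B s))"
  proof (rule card_UN_disjoint)
    have "finite (\<Pi>\<^sub>E i\<in>I. {1..card (V i)})" using assms by (intro finite_PiE) auto
    then show "finite ?Y" by auto
    show "\<forall>s\<in>?Y. finite (?B s)" using assms by (intro ballI finite_PiE) auto
    show "\<forall>s\<in>?Y. \<forall>t\<in>?Y. s \<noteq> t \<longrightarrow> ?B s \<inter> ?B t = {}"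
    proof (intro ballI impI equals0I)
      fix s t S assume st: "s \<in> ?Y" "t \<in> ?Y" "s \<noteq> t" "S \<in> ?B s \<inter> ?B t"
      have "s i = t i" if "i \<in> I" for i
        using PiE_mem[of S I "\<lambda>i. {B. B \<subseteq> V i \<and> card B = s i}" i]
          PiE_mem[of S I "\<lambda>i. {B. B \<subseteq> V i \<and> card B = t i}" i] st(4) that by auto
      then have "s = t" using st(1,2) by (intro PiE_ext[of s I _ t]) auto
      then show False using st(3) by simp
    qed
  qed
  moreover have "card (?B s) = (\<Prod>i\<in>I. card (V i) choose s i)" for s
    using assms by (simp add: card_PiE n_subsets)
  ultimately show ?thesis by simp
qed

section \<open>Polynomials with prescribed double roots\<close>

text \<open>Gaussian elimination: an unknown \<open>y\<close> with nonzero coefficient in equation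
  \<open>j\<close> is eliminated from the other equations, leaving one equation and one unknown
  fewer.\<close>

lemma homogeneous_system_nontrivial:
  fixes a :: "'j \<Rightarrow> 'x \<Rightarrow> real"
  assumes "finite J" "finite X" "card J < card X"
  shows "\<exists>u. (\<exists>x\<in>X. u x \<noteq> 0) \<and> (\<forall>j\<in>J. (\<Sum>x\<in>X. a j x * u x) = 0)"
  using assms
proof (induction arbitrary: X a rule: finite_induct)
  case empty
  then obtain x where "x \<in> X" by fastforce
  then show ?case by (intro exI[of _ "\<lambda>_. 1"]) auto
next
  case (insert j J)
  show ?case
  proof (cases "\<forall>x\<in>X. a j x = 0")
    case True
    moreover have "card J < card X" using insert by auto
    ultimately show ?thesis using insert.IH[of X a] insert.prems(1) by auto
  next
    case False
    then obtain y where y: "y \<in> X" "a j y \<noteq> 0" by auto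
    let ?X = "X - {y}"
    have "card J < card ?X" using insert y by auto
    then obtain u where u: "\<exists>x\<in>?X. u x \<noteq> 0"
      "\<forall>i\<in>J. (\<Sum>x\<in>?X. (a i x - a i y * a j x / a j y) * u x) = 0"
      using insert.IH[of ?X "\<lambda>i x. a i x - a i y * a j x / a j y"] insert.prems by auto
    define R where "R = (\<Sum>x\<in>?X. a j x * u x)"
    \<comment> \<open>The value at \<open>y\<close> is obtained by solving equation
      \<open>j\<close>.\<close>
    define v where "v = u(y := - R / a j y)"
    have split: "(\<Sum>x\<in>X. a i x * v x) = (\<Sum>x\<in>?X. a i x * u x) - a i y * R / a j y" for i
    proof -
      have "(\<Sum>x\<in>X. a i x * v x) = a i y * v y + (\<Sum>x\<in>?X. a i x * v x)"
        using y insert.prems by (intro sum.remove)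
      also have "(\<Sum>x\<in>?X. a i x * v x) = (\<Sum>x\<in>?X. a i x * u x)"
        by (rule sum.cong) (auto simp: v_def)
      finally show ?thesis by (simp add: v_def)
    qed
    have "(\<Sum>x\<in>X. a i x * v x) = 0" if "i \<in> insert j J" for i
    proof (cases "i = j")
      case True
      then show ?thesis using split[of j] y by (simp add: R_def)
    next
      case False
      then have "0 = (\<Sum>x\<in>?X. (a i x - a i y * a j x / a j y) * u x)" using u that by auto
      also have "\<dots> = (\<Sum>x\<in>?X. a i x * u x) - (\<Sum>x\<in>?X. (a i y / a j y) * (a j x * u x))"
        unfolding sum_subtractf[symmetric] by (rule sum.cong) (auto simp: algebra_simps)
      also have "\<dots> = (\<Sum>x\<in>?X. a i x * u x) - a i y * R / a j y"
        unfolding R_def sum_distrib_left[symmetric] by simp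
      finally show ?thesis using split[of i] by simp
    qed
    moreover have "\<exists>x\<in>X. v x \<noteq> 0" using u(1) by (auto simp: v_def)
    ultimately show ?thesis by blast
  qed
qed

text \<open>The mean value theorem gives a critical point in each gap between consecutive points of
  \<open>A\<close>. Disjointness from \<open>A\<close> allows known critical points on
  \<open>A\<close> to be added before a second application; the last clause keeps the new zeros
  inside any interval containing \<open>A\<close>.\<close>

lemma poly_Rolle_card:
  fixes p :: "real poly"
  assumes "finite A" "A \<noteq> {}" "\<forall>x\<in>A. poly p x = 0"
  shows "\<exists>B. finite B \<and> card B + 1 = card A \<and> B \<inter> A = {} \<and> (\<forall>b\<in>B. poly (pderiv p) b = 0) \<and>
    (\<forall>b\<in>B. \<exists>x\<in>A. \<exists>y\<in>A. x < b \<and> b < y)"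
  using assms
proof (induction rule: finite_linorder_max_induct)
  case (insert m A)
  show ?case
  proof (cases "A = {}")
    case True
    then show ?thesis by (intro exI[of _ "{}"]) auto
  next
    case False
    then obtain B where B: "finite B" "card B + 1 = card A" "B \<inter> A = {}"
      "\<forall>b\<in>B. poly (pderiv p) b = 0" "\<forall>b\<in>B. \<exists>x\<in>A. \<exists>y\<in>A. x < b \<and> b < y"
      using insert by auto
    define a where "a = Max A"
    have a: "a \<in> A" "\<forall>x\<in>A. x \<le> a" unfolding a_def using insert False by auto
    have "a < m" using a insert by auto
    then obtain b where b: "a < b" "b < m" "poly p m - poly p a = (m - a) * poly (pderiv p) b"
      using poly_MVT by blast
    then have pb: "poly (pderiv p) b = 0" using insert.prems a \<open>a < m\<close> by auto
    have "b \<notin> A" using a b by auto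
    have less: "x < b" if "x \<in> B" for x using B(5) a b that by fastforce
    then have "b \<notin> B" "m \<notin> B" using b by fastforce+
    have "m \<notin> A" using insert by auto
    show ?thesis
    proof (intro exI[of _ "insert b B"] conjI)
      show "\<forall>c\<in>insert b B. \<exists>x\<in>insert m A. \<exists>y\<in>insert m A. x < c \<and> c < y"
        using B(5) a b by blast
      show "insert b B \<inter> insert m A = {}"
        using B(3) b \<open>b \<notin> A\<close> \<open>m \<notin> B\<close> by auto
    qed (use B pb \<open>b \<notin> B\<close> \<open>m \<notin> A\<close> insert.hyps in auto)
  qed
qed auto

text \<open>Rolle gives \<open>card A - 1\<close> zeros of the first derivative off
  \<open>A\<close>, to which the double roots \<open>S\<close> are added. Rolle again gives
  \<open>card A + card S - 2\<close> zeros of the second derivative off \<open>S\<close>, to which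
  \<open>E\<close>, the zeros of order at least three, is added.\<close>

lemma poly_Rolle_double_card:
  fixes p :: "real poly"
  assumes "finite A" "S \<subseteq> A" "S \<noteq> {}" "E \<subseteq> S"
    and "\<forall>x\<in>A. poly p x = 0" "\<forall>x\<in>S. poly (pderiv p) x = 0" "\<forall>x\<in>E. poly (pderiv (pderiv p)) x = 0"
  shows "\<exists>C. finite C \<and> card C + 2 = card A + card S + card E \<and>
    (\<forall>c\<in>C. poly (pderiv (pderiv p)) c = 0) \<and> (\<forall>c\<in>C. \<exists>x\<in>A. \<exists>y\<in>A. x \<le> c \<and> c \<le> y)"
proof -
  have finS: "finite S" "finite E" using assms finite_subset by metis+
  obtain B where B: "finite B" "card B + 1 = card A" "B \<inter> A = {}"
      "\<forall>b\<in>B. poly (pderiv p) b = 0" "\<forall>b\<in>B. \<exists>x\<in>A. \<exists>y\<in>A. x < b \<and> b < y"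
    using poly_Rolle_card[of A p] assms by auto
  have BS: "card (B \<union> S) = card B + card S"
    using B finS assms by (intro card_Un_disjoint) auto
  obtain D where D: "finite D" "card D + 1 = card (B \<union> S)" "D \<inter> (B \<union> S) = {}"
      "\<forall>b\<in>D. poly (pderiv (pderiv p)) b = 0" "\<forall>b\<in>D. \<exists>x\<in>B\<union>S. \<exists>y\<in>B\<union>S. x < b \<and> b < y"
    using poly_Rolle_card[of "B \<union> S" "pderiv p"] assms(3,6) B(1,4) finS by blast
  have "card (D \<union> E) = card D + card E"
    using D finS assms by (intro card_Un_disjoint) auto
  moreover have hull: "\<exists>x\<in>A. \<exists>y\<in>A. x \<le> c \<and> c \<le> y" if "c \<in> B \<union> S" for c
  proof (cases "c \<in> B")
    case True
    then show ?thesis using B(5) less_imp_le by metis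
  next
    case False
    then show ?thesis using that assms(2) by auto
  qed
  have "\<exists>x\<in>A. \<exists>y\<in>A. x \<le> c \<and> c \<le> y" if c: "c \<in> D" for c
  proof -
    obtain x y where "x \<in> B \<union> S" "y \<in> B \<union> S" "x < c" "c < y" using D(5) c by blast
    then show ?thesis using hull[of x] hull[of y] by (meson less_imp_le order_trans)
  qed
  then have "\<forall>c\<in>D \<union> E. \<exists>x\<in>A. \<exists>y\<in>A. x \<le> c \<and> c \<le> y" using hull assms(4) by blast
  ultimately show ?thesis
    using B(1,2) D(1,2,4) BS finS assms(7) by (intro exI[of _ "D \<union> E"]) auto
qed

section \<open>Divisibility by double roots and signs of interpolants\<close>

lemma prod_linear_power_dvd:
  fixes p :: "'a::field poly"
  assumes "finite S" "\<forall>s\<in>S. [:-s, 1:] ^ k dvd p"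
  shows "(\<Prod>s\<in>S. [:-s, 1:] ^ k) dvd p"
  using assms
proof (induction arbitrary: p rule: finite_induct)
  case (insert s S)
  then obtain p1 where p1: "p = [:-s, 1:] ^ k * p1" by (auto elim: dvdE)
  have "[:-t, 1:] ^ k dvd p1" if t: "t \<in> S" for t
  proof (cases "p1 = 0")
    case False
    have "s \<noteq> t" using insert t by auto
    then have "order t ([:-s, 1:] ^ k) = 0" by (intro order_0I) (simp add: poly_power)
    moreover have "p \<noteq> 0" using False p1 by simp
    ultimately have "order t p = order t p1" using p1 by (simp add: order_mult)
    moreover have "k \<le> order t p"
      using insert.prems t \<open>p \<noteq> 0\<close> order_divides[of t k p] by auto
    ultimately show ?thesis by (simp add: order_divides)
  qed auto
  then have "(\<Prod>s\<in>S. [:-s, 1:] ^ k) dvd p1" using insert.IH by auto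
  then show ?case using insert.hyps p1 by (simp add: mult_dvd_mono)
qed auto

lemma pderiv_linear: "pderiv [:-s, 1:] = (1 :: real poly)"
  by (rule poly_eqI) (simp add: coeff_pderiv coeff_pCons split: nat.split)

lemma pderiv_sum: "pderiv (sum f A) = (\<Sum>x\<in>A. pderiv (f x))"
  by (induction A rule: infinite_finite_induct) (auto simp: pderiv_add)

lemma double_root_dvd:
  fixes p :: "real poly"
  assumes "poly p s = 0" "poly (pderiv p) s = 0"
  shows "[:-s, 1:]\<^sup>2 dvd p"
proof -
  obtain q where q: "p = [:-s, 1:] * q" using assms(1) by (auto simp: poly_eq_0_iff_dvd elim: dvdE)
  have "poly (pderiv p) s = poly q s" 
    unfolding q pderiv_mult by (simp add: pderiv_linear del: mult_pCons_left)
  then obtain r where "q = [:-s, 1:] * r" using assms(2) by (auto simp: poly_eq_0_iff_dvd elim: dvdE)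
  then have "p = [:-s, 1:]\<^sup>2 * r" unfolding q power2_eq_square by (simp only: mult.assoc)
  then show ?thesis by (rule dvdI)
qed

lemma poly_pderiv2_double_root:
  "poly (pderiv (pderiv ([:-s, 1:]\<^sup>2 * v))) s = 2 * poly v (s::real)"
  unfolding power2_eq_square mult.assoc
  by (simp add: pderiv_mult pderiv_add pderiv_linear del: mult_pCons_left mult_pCons_right)

lemma poly_eq_smult_prod_roots:
  fixes g :: "real poly"
  assumes "finite C" "\<forall>c\<in>C. poly g c = 0" "degree g \<le> card C"
  obtains l where "g = smult l (\<Prod>c\<in>C. [:-c, 1:])"
proof -
  have "(\<Prod>c\<in>C. [:-c, 1:] ^ 1) dvd g"
    using assms by (intro prod_linear_power_dvd) (auto simp: poly_eq_0_iff_dvd)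
  then obtain h where h: "g = (\<Prod>c\<in>C. [:-c, 1:]) * h" by (auto elim: dvdE)
  have "degree h = 0"
  proof (cases "h = 0")
    case False
    have "degree (\<Prod>c\<in>C. [:-c, 1:]) = card C" by (subst degree_prod_eq_sum_degree) auto
    moreover have "degree g = degree (\<Prod>c\<in>C. [:-c, 1:]) + degree h"
      unfolding h using False assms(1) by (intro degree_mult_eq) (auto simp: prod_zero_iff)
    ultimately show ?thesis using assms(3) by simp
  qed auto
  then obtain l where "h = [:l:]" by (auto elim: degree_eq_zeroE)
  then show thesis using that[of l] h by simp
qed

text \<open>Dividing out the squared linear factors leaves a cofactor \<open>h\<close> without zeros
  on \<open>J\<close>: off \<open>S\<close> because \<open>f\<close> has none, on \<open>S\<close>
  because \<open>h\<close> is there a positive multiple of the second derivative. By the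
  intermediate value theorem \<open>h\<close> keeps the sign it has at \<open>x0\<close>.\<close>

lemma double_interpolant_pos:
  fixes f :: "real poly" and J :: "real set"
  assumes "finite S" "x0 \<in> S" "S \<subseteq> J" "is_interval J"
    and root: "\<forall>s\<in>S. poly f s = 0 \<and> poly (pderiv f) s = 0"
    and ne: "\<forall>t\<in>J - S. poly f t \<noteq> 0" "\<forall>s\<in>S. poly (pderiv (pderiv f)) s \<noteq> 0"
    and pos: "poly (pderiv (pderiv f)) x0 > 0" and t: "t \<in> J - S"
  shows "poly f t > 0"
proof -
  let ?w = "\<lambda>S. \<Prod>s\<in>S. [:-s, 1:]\<^sup>2 :: real poly"
  have "?w S dvd f" using assms(1) root by (intro prod_linear_power_dvd) (auto simp: double_root_dvd)
  then obtain h where h: "f = ?w S * h" by (auto elim: dvdE)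
  have wpos: "poly (?w A) x > 0" if "x \<notin> A" for x and A :: "real set"
  proof -
    have "poly (?w A) x = (\<Prod>s\<in>A. (x - s)\<^sup>2)" by (simp add: poly_prod poly_power)
    also have "\<dots> > 0" using that by (intro prod_pos) auto
    finally show ?thesis .
  qed
  have second: "poly (pderiv (pderiv f)) s = 2 * (poly (?w (S - {s})) s * poly h s)" if "s \<in> S" for s
  proof -
    have "?w S = [:-s, 1:]\<^sup>2 * ?w (S - {s})" using assms(1) that by (rule prod.remove)
    then have "f = [:-s, 1:]\<^sup>2 * (?w (S - {s}) * h)" using h by (simp only: mult.assoc)
    then show ?thesis using poly_pderiv2_double_root[of s "?w (S - {s}) * h"] by (simp only: poly_mult)
  qed
  have hx: "poly h x0 > 0"
    using second[OF assms(2)] pos wpos[of x0 "S - {x0}"] by (simp add: zero_less_mult_iff)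
  have hne: "poly h x \<noteq> 0" if "x \<in> J" for x
  proof (cases "x \<in> S")
    case True
    then show ?thesis using second ne(2) by fastforce
  next
    case False
    then show ?thesis using ne(1) that h by auto
  qed
  have "poly h t > 0"
  proof (rule ccontr)
    assume "\<not> poly h t > 0"
    then have neg: "poly h t < 0" using hne[of t] t by auto
    have "x0 \<in> J" "t \<in> J" using assms t by auto
    then have "x \<in> J" if "min x0 t \<le> x" "x \<le> max x0 t" for x
      using \<open>is_interval J\<close> that unfolding is_interval_1 by (metis max_def min_def)
    moreover have "min x0 t < max x0 t" using hx neg 
      by (metis less_irrefl less_trans linorder_neqE_linordered_idom max_def min_def not_le)
    moreover have "poly h (min x0 t) * poly h (max x0 t) < 0"
      using hx neg by (auto simp: min_def max_def mult_less_0_iff)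
    ultimately show False using poly_IVT[of "min x0 t" "max x0 t" h] hne by (metis less_imp_le)
  qed
  then show ?thesis using wpos[of t S] t h by simp
qed

lemma prod_even_pos:
  fixes x :: real
  assumes "finite C" "even (card C)" "(\<forall>c\<in>C. c < x) \<or> (\<forall>c\<in>C. x < c)"
  shows "(\<Prod>c\<in>C. x - c) > 0"
  using assms(3)
proof
  assume "\<forall>c\<in>C. c < x" then show ?thesis by (intro prod_pos) auto
next
  assume "\<forall>c\<in>C. x < c"
  then have "(\<Prod>c\<in>C. c - x) > 0" by (intro prod_pos) auto
  moreover have "(\<Prod>c\<in>C. x - c) = (\<Prod>c\<in>C. (-1) * (c - x))" by simp
  moreover have "\<dots> = (\<Prod>c\<in>C. c - x)"
    using assms by (simp only: prod.distrib prod_constant) (simp)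
  ultimately show ?thesis by simp
qed

text \<open>The \<open>D - 1\<close> coefficients of \<open>q\<close> and two more for each index
  are unknowns of a homogeneous linear system; the relation on \<open>D\<close> makes them exactly
  one more than the equations.\<close>

lemma interpolation_family_nontrivial:
  fixes S :: "'i \<Rightarrow> real set"
  assumes "finite I" and S: "\<forall>i\<in>I. finite (S i) \<and> S i \<noteq> {}"
    and D: "D + 2 * card I = 2 * (\<Sum>i\<in>I. card (S i)) + 2"
  obtains q a b where "degree q \<le> D" "coeff q 0 = 0" "coeff q 1 = 0"
    "q \<noteq> 0 \<or> (\<exists>i\<in>I. a i \<noteq> 0 \<or> b i \<noteq> 0)"
    "\<forall>i\<in>I. \<forall>s\<in>S i. poly (q + [:a i, b i:]) s = 0 \<and> poly (pderiv (q + [:a i, b i:])) s = 0"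
proof -
  \<comment> \<open>\<open>Inl j\<close> stands for the coefficient of \<open>t ^ j\<close> in
    \<open>q\<close>, \<open>Inr (i, 0)\<close> for \<open>a i\<close> and \<open>Inr (i, 1)\<close>
    for \<open>b i\<close>. The Boolean in \<open>?J\<close> is \<open>True\<close> for the value
    condition and \<open>False\<close> for the derivative condition.\<close>
  let ?Q = "Inl ` {2..D} :: (nat + 'i \<times> nat) set" and ?L = "Inr ` (I \<times> {0, 1}) :: (nat + 'i \<times> nat) set"
  let ?J = "(SIGMA i:I. S i) \<times> (UNIV :: bool set)"
  define A :: "('i \<times> real) \<times> bool \<Rightarrow> nat + 'i \<times> nat \<Rightarrow> real" where
    "A = (\<lambda>((i, s), z) x. case x of Inl j \<Rightarrow> if z then s ^ j else real j * s ^ (j - 1)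
      | Inr (i', e) \<Rightarrow> if i' = i then (if z then s ^ e else real e) else 0)"
  have cardJ: "card ?J = 2 * (\<Sum>i\<in>I. card (S i))"
    using assms by (simp add: card_cartesian_product)
  have "card I \<le> (\<Sum>i\<in>I. card (S i))"
    using sum_mono[of I "\<lambda>_. 1" "\<lambda>i. card (S i)"] S by (simp add: Suc_leI card_gt_0_iff)
  then have D2: "2 \<le> D" using D by linarith
  have "card (?Q \<union> ?L) = card ?Q + card ?L" using assms by (intro card_Un_disjoint) auto
  also have "card ?Q = D - 1" using D2 by (simp add: card_image)
  also have "card ?L = 2 * card I"
    using assms by (subst card_image) (auto simp: card_cartesian_product)
  finally have "card ?J < card (?Q \<union> ?L)" using cardJ D D2 by linarith
  moreover have "finite ?J" "finite (?Q \<union> ?L)" using assms by auto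
  ultimately have "\<exists>u. (\<exists>x\<in>?Q \<union> ?L. u x \<noteq> 0) \<and> (\<forall>j\<in>?J. (\<Sum>x\<in>?Q \<union> ?L. A j x * u x) = 0)"
    by (intro homogeneous_system_nontrivial)
  then obtain u where u: "\<exists>x\<in>?Q \<union> ?L. u x \<noteq> 0"
    "\<forall>j\<in>?J. (\<Sum>x\<in>?Q \<union> ?L. A j x * u x) = 0"
    by (elim exE conjE)
  define q where "q = (\<Sum>j\<in>{2..D}. monom (u (Inl j)) j)"
  define a where "a = (\<lambda>i. u (Inr (i, 0)))"
  define b where "b = (\<lambda>i. u (Inr (i, 1)))"
  have coeff: "coeff q j = (if j \<in> {2..D} then u (Inl j) else 0)" for j
    by (auto simp: q_def coeff_sum)
  have eq: "(\<Sum>x\<in>?Q \<union> ?L. A ((i, s), z) x * u x) =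
      (if z then poly (q + [:a i, b i:]) s else poly (pderiv (q + [:a i, b i:])) s)"
    if "i \<in> I" for i s z
  proof -
    have "(\<Sum>x\<in>?L. A ((i, s), z) x * u x) = (\<Sum>y\<in>I \<times> {0, 1}. A ((i, s), z) (Inr y) * u (Inr y))"
      by (subst sum.reindex) auto
    also have "\<dots> = (\<Sum>i'\<in>I. \<Sum>e\<in>{0, 1}. A ((i, s), z) (Inr (i', e)) * u (Inr (i', e)))"
      by (subst sum.cartesian_product) (simp add: case_prod_unfold)
    also have "\<dots> = (\<Sum>i'\<in>I. if i' = i then (if z then a i + b i * s else b i) else 0)"
      by (rule sum.cong) (auto simp: A_def a_def b_def)
    also have "\<dots> = (if z then a i + b i * s else b i)" using that assms by simp
    finally have L: "(\<Sum>x\<in>?L. A ((i, s), z) x * u x) = (if z then a i + b i * s else b i)" .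
    have "(\<Sum>x\<in>?Q. A ((i, s), z) x * u x) = (\<Sum>j\<in>{2..D}. A ((i, s), z) (Inl j) * u (Inl j))"
      by (subst sum.reindex) auto
    also have "\<dots> = (if z then poly q s else poly (pderiv q) s)"
      by (auto simp: A_def q_def poly_sum poly_monom pderiv_sum pderiv_monom intro!: sum.cong)
    finally have Q: "(\<Sum>x\<in>?Q. A ((i, s), z) x * u x) = (if z then poly q s else poly (pderiv q) s)" .
    have "(\<Sum>x\<in>?Q \<union> ?L. A ((i, s), z) x * u x) =
      (\<Sum>x\<in>?Q. A ((i, s), z) x * u x) + (\<Sum>x\<in>?L. A ((i, s), z) x * u x)"
      using assms by (intro sum.union_disjoint) auto
    then show ?thesis using L Q by (simp add: pderiv_add pderiv_pCons mult.commute)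
  qed
  show thesis
  proof (rule that)
    show "degree q \<le> D" by (rule degree_le) (auto simp: coeff)
    show "coeff q 0 = 0" "coeff q 1 = 0" by (auto simp: coeff)
    show "q \<noteq> 0 \<or> (\<exists>i\<in>I. a i \<noteq> 0 \<or> b i \<noteq> 0)"
    proof -
      obtain x where x: "x \<in> ?Q \<union> ?L" "u x \<noteq> 0" using u by auto
      show ?thesis
      proof (cases x)
        case (Inl j)
        then have "coeff q j \<noteq> 0" using x by (auto simp: coeff)
        then show ?thesis by auto
      next
        case (Inr y)
        then show ?thesis using x by (auto simp: a_def b_def)
      qed
    qed
    show "\<forall>i\<in>I. \<forall>s\<in>S i. poly (q + [:a i, b i:]) s = 0 \<and> poly (pderiv (q + [:a i, b i:])) s = 0"
    proof (intro ballI)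
      fix i s assume "i \<in> I" "s \<in> S i"
      then have "((i, s), True) \<in> ?J" "((i, s), False) \<in> ?J" by auto
      then show "poly (q + [:a i, b i:]) s = 0 \<and> poly (pderiv (q + [:a i, b i:])) s = 0"
        using u(2) eq[OF \<open>i \<in> I\<close>, of s True] eq[OF \<open>i \<in> I\<close>, of s False] by simp
    qed
  qed
qed

text \<open>The polynomials share their second derivative \<open>g\<close>. Rolle on the disjoint
  intervals already yields \<open>D - 2\<close> zeros of \<open>g\<close>, all that its degree
  allows. Hence there is no further zero and no triple zero, and the location of the zeros of
  \<open>g\<close> gives it the same sign at all points \<open>Max (S i)\<close>.\<close>

theorem interpolation_family_pos:
  fixes S :: "'i \<Rightarrow> real set" and J :: "'i \<Rightarrow> real set"
  assumes "finite I" "I \<noteq> {}" and S: "\<forall>i\<in>I. finite (S i) \<and> S i \<noteq> {} \<and> S i \<subseteq> J i"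
    and J: "\<forall>i\<in>I. is_interval (J i)" "disjoint_family_on J I"
    and D: "D + 2 * card I = 2 * (\<Sum>i\<in>I. card (S i)) + 2"
  obtains q a b where "degree q \<le> D" "coeff q 0 = 0" "coeff q 1 = 0"
    "\<forall>i\<in>I. \<forall>t\<in>J i. (t \<in> S i \<longrightarrow> poly (q + [:a i, b i:]) t = 0) \<and>
      (t \<notin> S i \<longrightarrow> poly (q + [:a i, b i:]) t > 0)"
proof -
  obtain q a b where q: "degree q \<le> D" "coeff q 0 = 0" "coeff q 1 = 0"
    and nontrivial: "q \<noteq> 0 \<or> (\<exists>i\<in>I. a i \<noteq> 0 \<or> b i \<noteq> 0)"
    and root: "\<forall>i\<in>I. \<forall>s\<in>S i. poly (q + [:a i, b i:]) s = 0 \<and> poly (pderiv (q + [:a i, b i:])) s = 0"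
  proof -
    have "\<forall>i\<in>I. finite (S i) \<and> S i \<noteq> {}" using S by auto
    then show ?thesis using that by (rule interpolation_family_nontrivial[OF assms(1) _ D])
  qed
  define g where "g = pderiv (pderiv q)"
  have g: "pderiv (pderiv (q + [:\<alpha>, \<beta>:])) = g" for \<alpha> \<beta>
    by (simp add: g_def pderiv_add pderiv_pCons)
  have degg: "degree g \<le> D - 2" using q(1) by (simp add: g_def degree_pderiv)
  \<comment> \<open>If \<open>g\<close> were zero, then so would be \<open>q\<close>, which has no
    terms below degree 2; each remaining linear polynomial would have a double root and vanish,
    against nontriviality.\<close>
  have g0: "g \<noteq> 0"
  proof
    assume "g = 0"
    have "coeff q j = 0" for j
    proof (cases "j < 2")
      case True
      then have "j = 0 \<or> j = 1" by auto
      then show ?thesis using q by auto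
    next
      case False
      then obtain m where j: "j = Suc (Suc m)" by (metis add_2_eq_Suc le_Suc_ex not_less)
      have "coeff g m = 0" using \<open>g = 0\<close> by simp
      then have "real (Suc m) * (real (Suc (Suc m)) * coeff q j) = 0"
        unfolding g_def coeff_pderiv j by simp
      then show ?thesis by (simp del: of_nat_Suc)
    qed
    then have "q = 0" using poly_eqI[of q 0] by simp
    moreover have "a i = 0 \<and> b i = 0" if "i \<in> I" for i
    proof -
      have "S i \<noteq> {}" using S that by simp
      then obtain s where "s \<in> S i" by auto
      then have "poly [:a i, b i:] s = 0" "poly (pderiv [:a i, b i:]) s = 0"
        using root that \<open>q = 0\<close> by auto
      then show ?thesis by (simp add: pderiv_pCons)
    qed
    ultimately show False using nontrivial by blast
  qed
  have cardS: "1 \<le> card (S i)" if "i \<in> I" for i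
    using S that by (simp add: Suc_leI card_gt_0_iff)
  \<comment> \<open>The sets \<open>A\<close> and \<open>E\<close> stay free because the count is
    used with an additional zero, with an additional zero of the second derivative, and with
    neither.\<close>
  have count: "\<exists>C. (\<forall>i\<in>I. finite (C i) \<and> C i \<subseteq> J i \<and> card (C i) + 2 = card (A i) + card (S i) + card (E i) \<and>
        (\<forall>c\<in>C i. poly g c = 0) \<and> (\<forall>c\<in>C i. \<exists>x\<in>A i. \<exists>y\<in>A i. x \<le> c \<and> c \<le> y))"
    if A: "\<forall>i\<in>I. finite (A i) \<and> S i \<subseteq> A i \<and> A i \<subseteq> J i \<and> (\<forall>x\<in>A i. poly (q + [:a i, b i:]) x = 0)"
      and E: "\<forall>i\<in>I. E i \<subseteq> S i \<and> (\<forall>x\<in>E i. poly g x = 0)" for A E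
  proof -
    have "\<forall>i\<in>I. \<exists>C. finite C \<and> C \<subseteq> J i \<and> card C + 2 = card (A i) + card (S i) + card (E i) \<and>
        (\<forall>c\<in>C. poly g c = 0) \<and> (\<forall>c\<in>C. \<exists>x\<in>A i. \<exists>y\<in>A i. x \<le> c \<and> c \<le> y)"
    proof
      fix i assume i: "i \<in> I"
      have "\<exists>C. finite C \<and> card C + 2 = card (A i) + card (S i) + card (E i) \<and>
        (\<forall>c\<in>C. poly (pderiv (pderiv (q + [:a i, b i:]))) c = 0) \<and> (\<forall>c\<in>C. \<exists>x\<in>A i. \<exists>y\<in>A i. x \<le> c \<and> c \<le> y)"
        by (rule poly_Rolle_double_card) (use i S root A E g in auto)
      then obtain C where C: "finite C" "card C + 2 = card (A i) + card (S i) + card (E i)"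
        "\<forall>c\<in>C. poly g c = 0" "\<forall>c\<in>C. \<exists>x\<in>A i. \<exists>y\<in>A i. x \<le> c \<and> c \<le> y" unfolding g by blast
      have "C \<subseteq> J i"
      proof
        fix c assume "c \<in> C"
        then obtain x y where "x \<in> A i" "y \<in> A i" "x \<le> c" "c \<le> y" using C by blast
        moreover have "A i \<subseteq> J i" "is_interval (J i)" using A J i by auto
        ultimately show "c \<in> J i" unfolding is_interval_1 by blast
      qed
      then show "\<exists>C. finite C \<and> C \<subseteq> J i \<and> card C + 2 = card (A i) + card (S i) + card (E i) \<and>
        (\<forall>c\<in>C. poly g c = 0) \<and> (\<forall>c\<in>C. \<exists>x\<in>A i. \<exists>y\<in>A i. x \<le> c \<and> c \<le> y)" using C by blast
    qed
    then show ?thesis by (rule bchoice)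
  qed
  have disj: "\<forall>i\<in>I. \<forall>j\<in>I. i \<noteq> j \<longrightarrow> C i \<inter> C j = {}" if "\<forall>i\<in>I. C i \<subseteq> J i" for C
    using J(2) that unfolding disjoint_family_on_def by blast
  \<comment> \<open>Disjoint intervals keep the zeros of \<open>g\<close> from different blocks
    distinct, so their numbers add up to at most \<open>degree g\<close>.\<close>
  have bound: "(\<Sum>i\<in>I. card (A i) + card (S i) + card (E i)) \<le> (\<Sum>i\<in>I. card (S i) + card (S i))"
    if A: "\<forall>i\<in>I. finite (A i) \<and> S i \<subseteq> A i \<and> A i \<subseteq> J i \<and> (\<forall>x\<in>A i. poly (q + [:a i, b i:]) x = 0)"
      and E: "\<forall>i\<in>I. E i \<subseteq> S i \<and> (\<forall>x\<in>E i. poly g x = 0)" for A E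
  proof -
    obtain C where C: "\<forall>i\<in>I. finite (C i) \<and> C i \<subseteq> J i \<and> card (C i) + 2 = card (A i) + card (S i) + card (E i) \<and>
        (\<forall>c\<in>C i. poly g c = 0) \<and> (\<forall>c\<in>C i. \<exists>x\<in>A i. \<exists>y\<in>A i. x \<le> c \<and> c \<le> y)"
      using count[OF A E] by (elim exE)
    have "card (\<Union>i\<in>I. C i) = (\<Sum>i\<in>I. card (C i))"
      by (rule card_UN_disjoint) (use C disj[of C] assms(1) in auto)
    moreover have "(\<Union>i\<in>I. C i) \<subseteq> {x. poly g x = 0}" using C by auto
    then have "card (\<Union>i\<in>I. C i) \<le> degree g"
      using card_mono[OF poly_roots_finite[OF g0]] card_poly_roots_bound[OF g0] order_trans by metis
    ultimately have "(\<Sum>i\<in>I. card (C i)) \<le> D - 2" using degg by linarith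
    moreover have "(\<Sum>i\<in>I. card (A i) + card (S i) + card (E i)) = (\<Sum>i\<in>I. card (C i) + 2)"
      using C by (intro sum.cong) auto
    moreover have "card I \<le> (\<Sum>i\<in>I. card (S i))"
      using sum_mono[of I "\<lambda>_. 1" "\<lambda>i. card (S i)"] cardS by simp
    ultimately show ?thesis using D unfolding sum.distrib by simp
  qed
  have ne_A: "poly (q + [:a i, b i:]) t \<noteq> 0" if i: "i \<in> I" and t: "t \<in> J i - S i" for i t
  proof
    assume "poly (q + [:a i, b i:]) t = 0"
    define A where "A = S(i := insert t (S i))"
    have "(\<Sum>j\<in>I. card (A j) + card (S j) + card ({} :: real set)) \<le> (\<Sum>j\<in>I. card (S j) + card (S j))"
      by (rule bound[of A "\<lambda>_. {}"]) (use S root \<open>poly (q + [:a i, b i:]) t = 0\<close> t in \<open>auto simp: A_def\<close>)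
    moreover have "(\<Sum>j\<in>I. card (S j) + card (S j)) < (\<Sum>j\<in>I. card (A j) + card (S j) + card ({} :: real set))"
      by (rule sum_strict_mono_ex1) (use S i t assms(1) in \<open>auto simp: A_def intro!: bexI[of _ i]\<close>)
    ultimately show False by linarith
  qed
  have ne_E: "poly g s \<noteq> 0" if i: "i \<in> I" and s: "s \<in> S i" for i s
  proof
    assume "poly g s = 0"
    define E where "E = (\<lambda>j. if j = i then {s} else {})"
    have "(\<Sum>j\<in>I. card (S j) + card (S j) + card (E j)) \<le> (\<Sum>j\<in>I. card (S j) + card (S j))"
      by (rule bound[of S E]) (use S root s \<open>poly g s = 0\<close> in \<open>auto simp: E_def\<close>)
    moreover have "(\<Sum>j\<in>I. card (S j) + card (S j)) < (\<Sum>j\<in>I. card (S j) + card (S j) + card (E j))"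
      by (rule sum_strict_mono_ex1) (use i assms(1) in \<open>auto simp: E_def intro!: bexI[of _ i]\<close>)
    ultimately show False by linarith
  qed
  have "\<exists>C. (\<forall>i\<in>I. finite (C i) \<and> C i \<subseteq> J i \<and> card (C i) + 2 = card (S i) + card (S i) + card ({} :: real set) \<and>
        (\<forall>c\<in>C i. poly g c = 0) \<and> (\<forall>c\<in>C i. \<exists>x\<in>S i. \<exists>y\<in>S i. x \<le> c \<and> c \<le> y))"
    by (rule count[of S "\<lambda>_. {}"]) (use S root in auto)
  then obtain C where C: "\<forall>i\<in>I. finite (C i) \<and> C i \<subseteq> J i \<and> card (C i) + 2 = card (S i) + card (S i) + card ({} :: real set) \<and>
        (\<forall>c\<in>C i. poly g c = 0) \<and> (\<forall>c\<in>C i. \<exists>x\<in>S i. \<exists>y\<in>S i. x \<le> c \<and> c \<le> y)"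
    by (elim exE)
  have dC: "\<forall>i\<in>I. \<forall>j\<in>I. i \<noteq> j \<longrightarrow> C i \<inter> C j = {}" using disj[of C] C by blast
  have "card (\<Union>i\<in>I. C i) = (\<Sum>i\<in>I. card (C i))"
    by (rule card_UN_disjoint) (use C dC assms(1) in auto)
  moreover have "(\<Sum>i\<in>I. card (C i) + 2) = (\<Sum>i\<in>I. 2 * card (S i))"
    using C by (intro sum.cong) auto
  then have "(\<Sum>i\<in>I. card (C i)) + 2 * card I = 2 * (\<Sum>i\<in>I. card (S i))"
    unfolding sum.distrib by (simp add: sum_distrib_left mult.commute)
  \<comment> \<open>With \<open>A = S\<close> and \<open>E\<close> empty, the zeros found reach the
    degree bound \<open>D - 2\<close>, so \<open>g\<close> is a constant times the product of their
    linear factors.\<close>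
  ultimately have "degree g \<le> card (\<Union>i\<in>I. C i)" using degg D by linarith
  then obtain l where l: "g = smult l (\<Prod>c\<in>(\<Union>i\<in>I. C i). [:-c, 1:])"
    using poly_eq_smult_prod_roots[of "\<Union>i\<in>I. C i" g] C assms(1) by auto
  have l0: "l \<noteq> 0" using g0 l by auto
  \<comment> \<open>Each block contributes an even number of factors of equal sign:
    \<open>C i\<close> lies strictly below \<open>Max (S i)\<close>, and \<open>C j\<close> for
    another \<open>j\<close> lies on one side of it because the interval \<open>J j\<close> misses
    it.\<close>
  have sgn: "sgn (poly g (Max (S i))) = sgn l" if i: "i \<in> I" for i
  proof -
    let ?x = "Max (S i)"
    have x: "?x \<in> S i" "\<forall>y\<in>S i. y \<le> ?x" using S i by auto
    have "(\<Prod>c\<in>(\<Union>j\<in>I. C j). ?x - c) = (\<Prod>j\<in>I. \<Prod>c\<in>C j. ?x - c)"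
      by (rule prod.UNION_disjoint) (use C dC assms(1) in auto)
    also have "\<dots> > 0"
    proof (rule prod_pos)
      fix j assume j: "j \<in> I"
      show "(\<Prod>c\<in>C j. ?x - c) > 0"
      proof (rule prod_even_pos)
        show "finite (C j)" using C j by auto
        have "card (C j) + 2 = 2 * card (S j)" using C j by auto
        then show "even (card (C j))" by presburger
        show "(\<forall>c\<in>C j. c < ?x) \<or> (\<forall>c\<in>C j. ?x < c)"
        proof (cases "j = i")
          case True
          have "c < ?x" if c: "c \<in> C i" for c
          proof -
            have "c \<noteq> ?x" using ne_E[OF i x(1)] C i c by auto
            moreover obtain y where "y \<in> S i" "c \<le> y" using C i c by blast
            ultimately show ?thesis using x(2) by fastforce
          qed
          then show ?thesis using True by auto
        next
          case False
          have "?x \<in> J i" using x(1) S i by blast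
          then have "?x \<notin> J j" using J(2) False i j unfolding disjoint_family_on_def by blast
          moreover have "C j \<subseteq> J j" "is_interval (J j)" using C J j by auto
          ultimately have "\<not> (c \<le> ?x \<and> ?x \<le> d)" if "c \<in> C j" "d \<in> C j" for c d
            using that unfolding is_interval_1 by blast
          then show ?thesis by (meson not_less)
        qed
      qed
    qed
    finally have "(\<Prod>c\<in>(\<Union>j\<in>I. C j). ?x - c) > 0" .
    moreover have "poly g ?x = l * (\<Prod>c\<in>(\<Union>j\<in>I. C j). ?x - c)"
      by (subst l) (simp add: poly_prod)
    ultimately show ?thesis by (simp add: sgn_mult)
  qed
  show thesis
  \<comment> \<open>Scaling by the common sign \<open>sgn l\<close> makes the second derivative
    positive at every \<open>Max (S i)\<close>.\<close>
  proof (rule that[of "smult (sgn l) q" "\<lambda>i. sgn l * a i" "\<lambda>i. sgn l * b i"])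
    show "degree (smult (sgn l) q) \<le> D" using q l0 by (simp add: sgn_if)
    show "coeff (smult (sgn l) q) 0 = 0" "coeff (smult (sgn l) q) 1 = 0" using q by auto
    show "\<forall>i\<in>I. \<forall>t\<in>J i. (t \<in> S i \<longrightarrow> poly (smult (sgn l) q + [:sgn l * a i, sgn l * b i:]) t = 0) \<and>
      (t \<notin> S i \<longrightarrow> poly (smult (sgn l) q + [:sgn l * a i, sgn l * b i:]) t > 0)"
    proof (intro ballI)
      fix i t assume i: "i \<in> I" and t: "t \<in> J i"
      have f: "smult (sgn l) q + [:sgn l * a i, sgn l * b i:] = smult (sgn l) (q + [:a i, b i:])"
        by (simp add: smult_add_right)
      have g': "pderiv (pderiv (smult (sgn l) (q + [:a i, b i:]))) = smult (sgn l) g"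
        by (simp only: pderiv_smult g)
      have "poly (smult (sgn l) (q + [:a i, b i:])) t > 0" if "t \<notin> S i"
      proof (rule double_interpolant_pos)
        show "finite (S i)" "S i \<subseteq> J i" "is_interval (J i)" using S J i by auto
        show "Max (S i) \<in> S i" using S i by auto
        show "\<forall>s\<in>S i. poly (smult (sgn l) (q + [:a i, b i:])) s = 0 \<and>
            poly (pderiv (smult (sgn l) (q + [:a i, b i:]))) s = 0"
          using root i unfolding pderiv_smult poly_smult by simp
        show "\<forall>t\<in>J i - S i. poly (smult (sgn l) (q + [:a i, b i:])) t \<noteq> 0"
          using ne_A[OF i] l0 unfolding poly_smult by (simp add: sgn_eq_0_iff)
        show "\<forall>s\<in>S i. poly (pderiv (pderiv (smult (sgn l) (q + [:a i, b i:])))) s \<noteq> 0"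
          unfolding g' using ne_E[OF i] l0 by (simp add: sgn_eq_0_iff)
        have "sgn l * poly g (Max (S i)) = \<bar>poly g (Max (S i))\<bar>"
          unfolding sgn[OF i, symmetric] by (simp add: sgn_mult_self_eq abs_sgn mult.commute)
        moreover have "poly g (Max (S i)) \<noteq> 0" using ne_E[OF i] Max_in[of "S i"] S i by blast
        ultimately show "poly (pderiv (pderiv (smult (sgn l) (q + [:a i, b i:])))) (Max (S i)) > 0"
          unfolding g' by simp
        show "t \<in> J i - S i" using t that by auto
      qed
      moreover have "poly (smult (sgn l) (q + [:a i, b i:])) t = 0" if "t \<in> S i"
        using root i that unfolding poly_smult by simp
      ultimately show "(t \<in> S i \<longrightarrow> poly (smult (sgn l) q + [:sgn l * a i, sgn l * b i:]) t = 0) \<and>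
        (t \<notin> S i \<longrightarrow> poly (smult (sgn l) q + [:sgn l * a i, sgn l * b i:]) t > 0)"
        unfolding f by blast
    qed
  qed
qed

section \<open>Perturbation of supporting functionals\<close>

text \<open>The functionals \<open>e\<close> in the hypothesis express linear independence of the
  vectors \<open>w0 s\<close>. In the induction step the hypothesis is used twice: for a functional
  tending to \<open>c0\<close> with correct values on \<open>S\<close>, and for one tending to
  \<open>e0\<close> that eventually vanishes on \<open>S\<close> but not at \<open>a\<close>, a
  multiple of which corrects the value at \<open>a\<close>.\<close>

lemma perturbed_functional:
  fixes w :: "'z \<Rightarrow> 'b \<Rightarrow> 'v::real_inner"
  assumes "finite S" "\<forall>s\<in>S. ((\<lambda>z. w z s) \<longlongrightarrow> w0 s) F"
    and "\<forall>a\<in>S. \<exists>e. e \<bullet> w0 a \<noteq> 0 \<and> (\<forall>s\<in>S - {a}. e \<bullet> w0 s = 0)"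
  shows "\<exists>c. (c \<longlongrightarrow> c0) F \<and> (\<forall>\<^sub>F z in F. \<forall>s\<in>S. c z \<bullet> w z s = c0 \<bullet> w0 s)"
  using assms
proof (induction arbitrary: c0 rule: finite_induct)
  case empty
  then show ?case by (intro exI[of _ "\<lambda>_. c0"]) auto
next
  case (insert a S)
  have dual: "\<forall>b\<in>S. \<exists>e. e \<bullet> w0 b \<noteq> 0 \<and> (\<forall>s\<in>S - {b}. e \<bullet> w0 s = 0)"
    using insert.prems(2) by (meson DiffD1 DiffD2 DiffI insertCI)
  obtain e0 where e0: "e0 \<bullet> w0 a \<noteq> 0" "\<forall>s\<in>S. e0 \<bullet> w0 s = 0"
    using insert.prems(2) insert.hyps(2) by (metis DiffI insertI1 insertI2 singletonD)
  obtain c where c: "(c \<longlongrightarrow> c0) F" "\<forall>\<^sub>F z in F. \<forall>s\<in>S. c z \<bullet> w z s = c0 \<bullet> w0 s"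
    using insert.IH[of c0] dual insert.prems(1) by blast
  obtain e where e: "(e \<longlongrightarrow> e0) F" "\<forall>\<^sub>F z in F. \<forall>s\<in>S. e z \<bullet> w z s = e0 \<bullet> w0 s"
    using insert.IH[of e0] dual insert.prems(1) by blast
  have wa: "((\<lambda>z. w z a) \<longlongrightarrow> w0 a) F" using insert.prems by auto
  have lim: "((\<lambda>z. e z \<bullet> w z a) \<longlongrightarrow> e0 \<bullet> w0 a) F" by (intro tendsto_inner e wa)
  then have ne: "\<forall>\<^sub>F z in F. e z \<bullet> w z a \<noteq> 0" using e0(1) by (rule tendsto_imp_eventually_ne)
  \<comment> \<open>This coefficient corrects the value at \<open>a\<close>; it tends to zero, so
    the limit \<open>c0\<close> is unchanged.\<close>
  define x where "x = (\<lambda>z. (c0 \<bullet> w0 a - c z \<bullet> w z a) / (e z \<bullet> w z a))"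
  have "(x \<longlongrightarrow> (c0 \<bullet> w0 a - c0 \<bullet> w0 a) / (e0 \<bullet> w0 a)) F"
    unfolding x_def by (intro tendsto_divide tendsto_diff tendsto_const tendsto_inner wa c lim e0(1))
  then have "((\<lambda>z. c z + x z *\<^sub>R e z) \<longlongrightarrow> c0 + 0 *\<^sub>R e0) F"
    by (intro tendsto_add tendsto_scaleR c e) simp
  moreover have "\<forall>\<^sub>F z in F. \<forall>s\<in>insert a S. (c z + x z *\<^sub>R e z) \<bullet> w z s = c0 \<bullet> w0 s"
    using c(2) e(2) ne
    by eventually_elim (use e0 in \<open>auto simp: inner_add_left x_def\<close>)
  ultimately show ?case by (intro exI[of _ "\<lambda>z. c z + x z *\<^sub>R e z"]) simp
qed

text \<open>The values on \<open>S\<close> are kept exactly at zero, while the finitely many strict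
  inequalities persist by continuity.\<close>

lemma perturbed_supporting_functional:
  fixes w :: "'z \<Rightarrow> 'b \<Rightarrow> 'v::real_inner"
  assumes "finite A" "S \<subseteq> A" "\<forall>s\<in>A. ((\<lambda>z. w z s) \<longlongrightarrow> w0 s) F"
    and "\<forall>a\<in>S. \<exists>e. e \<bullet> w0 a \<noteq> 0 \<and> (\<forall>s\<in>S - {a}. e \<bullet> w0 s = 0)"
    and c0: "\<forall>s\<in>S. c0 \<bullet> w0 s = 0" "\<forall>s\<in>A - S. c0 \<bullet> w0 s > 0"
  shows "\<forall>\<^sub>F z in F. \<exists>c. (\<forall>s\<in>S. c \<bullet> w z s = 0) \<and> (\<forall>s\<in>A - S. c \<bullet> w z s > 0)"
proof -
  have "finite S" using assms finite_subset by blast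
  then obtain c where c: "(c \<longlongrightarrow> c0) F" "\<forall>\<^sub>F z in F. \<forall>s\<in>S. c z \<bullet> w z s = c0 \<bullet> w0 s"
    using perturbed_functional[of S w w0 F c0] assms by blast
  have "\<forall>\<^sub>F z in F. c z \<bullet> w z s > 0" if "s \<in> A - S" for s
  proof (rule order_tendstoD)
    show "((\<lambda>z. c z \<bullet> w z s) \<longlongrightarrow> c0 \<bullet> w0 s) F" using c assms that by (intro tendsto_inner) auto
  qed (use c0 that in auto)
  then have "\<forall>\<^sub>F z in F. \<forall>s\<in>A - S. c z \<bullet> w z s > 0"
    using assms(1) by (intro eventually_ball_finite) auto
  with c(2) show ?thesis by eventually_elim (use c0 in auto)
qed

section \<open>Curves carrying the vertices\<close>

text \<open>The truncated subtractions are harmless for \<open>1 \<le> i \<le> r < d\<close>, where \<open>curve_exponent d r i\<close>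
  permutes \<open>{1..d}\<close>.\<close>

definition curve_exponent :: "nat \<Rightarrow> nat \<Rightarrow> nat \<Rightarrow> nat \<Rightarrow> nat" where
  "curve_exponent d r i p = (if p = i then 1 else if p < i then d - r + 1 + p
     else if p \<le> r then d - r + p else p - r + 1)"

text \<open>\<open>\<phi>\<close> numbers the coordinates of the finite index type, so that their
  roles can be given by arithmetic on positions.\<close>

definition curve :: "('d \<Rightarrow> nat) \<Rightarrow> nat \<Rightarrow> real \<Rightarrow> nat \<Rightarrow> real \<Rightarrow> real ^ 'd" where
  "curve \<phi> r z i t = (\<chi> x. (if \<phi> x \<le> r \<and> \<phi> x \<noteq> i then z else 1) * t ^ curve_exponent CARD('d) r i (\<phi> x))"

lemma bij_curve_exponent:
  assumes "1 \<le> i" "i \<le> r" "r < d"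
  shows "bij_betw (curve_exponent d r i) {1..d} {1..d}"
proof -
  have "inj_on (curve_exponent d r i) {1..d}"
    using assms by (auto simp: inj_on_def curve_exponent_def split: if_splits)
  moreover have "curve_exponent d r i ` {1..d} \<subseteq> {1..d}"
    using assms by (auto simp: curve_exponent_def split: if_splits)
  ultimately show ?thesis
    unfolding bij_betw_def using endo_inj_surj[of "{1..d}"] by blast
qed

lemma poly_altdef_le:
  fixes p :: "real poly"
  assumes "degree p \<le> d"
  shows "poly p t = coeff p 0 + (\<Sum>j\<in>{1..d}. coeff p j * t ^ j)"
proof -
  have "poly p t = (\<Sum>j\<le>d. coeff p j * t ^ j)"
    unfolding poly_altdef using assms by (intro sum.mono_neutral_left) (auto simp: coeff_eq_0)
  also have "{..d} = insert 0 {1..d}" by auto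
  finally show ?thesis by simp
qed

section \<open>Affine functionals on the curves as polynomials\<close>

locale curve_family =
  fixes \<phi> :: "'d::finite \<Rightarrow> nat" and r :: nat
  assumes bij: "bij_betw \<phi> UNIV {1..CARD('d)}" and r: "1 \<le> r" "r < CARD('d)"
begin

text \<open>Since \<open>r < CARD('d)\<close>, positions \<open>1\<close> to \<open>r\<close> name
  \<open>r\<close> different axes; a second copy of the space can thus store one height for each
  polytope.\<close>

definition \<psi> :: "nat \<Rightarrow> 'd" where "\<psi> = inv_into UNIV \<phi>"

lemma \<phi>_range: "1 \<le> \<phi> x" "\<phi> x \<le> CARD('d)"
  using bij_betwE[OF bij] by auto

lemma \<psi>_inverse: "\<phi> (\<psi> i) = i" if "1 \<le> i" "i \<le> r" for i
  using bij_betw_inv_into_right[OF bij, of i] that r by (simp add: \<psi>_def)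

lemma bij_exponent:
  assumes "1 \<le> i" "i \<le> r"
  shows "bij_betw (\<lambda>x. curve_exponent CARD('d) r i (\<phi> x)) UNIV {1..CARD('d)}"
  using bij_betw_trans[OF bij bij_curve_exponent[OF assms r(2)]] by (simp add: comp_def)

text \<open>For \<open>z \<noteq> 0\<close> the coordinates are nonzero multiples of the powers
  \<open>1\<close> to \<open>CARD('d)\<close> of \<open>t\<close> in some order, so the coefficients
  of \<open>p\<close> need only be permuted and rescaled.\<close>

lemma curve_functional_of_poly:
  fixes p :: "real poly"
  assumes "1 \<le> i" "i \<le> r" "z \<noteq> 0" "degree p \<le> CARD('d)"
  obtains c :: "real ^ 'd" and h where "\<And>t. poly p t = h - c \<bullet> curve \<phi> r z i t"
proof -
  let ?e = "\<lambda>x. curve_exponent CARD('d) r i (\<phi> x)"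
  let ?k = "\<lambda>x. if \<phi> x \<le> r \<and> \<phi> x \<noteq> i then z else 1"
  define c :: "real ^ 'd" where "c = (\<chi> x. - coeff p (?e x) / ?k x)"
  have "poly p t = coeff p 0 - c \<bullet> curve \<phi> r z i t" for t
  proof -
    have "(\<Sum>j\<in>{1..CARD('d)}. coeff p j * t ^ j) = (\<Sum>x\<in>UNIV. coeff p (?e x) * t ^ ?e x)"
      by (rule sum.reindex_bij_betw[OF bij_exponent[OF assms(1,2)], symmetric])
    also have "\<dots> = - (c \<bullet> curve \<phi> r z i t)"
      unfolding inner_vec_def c_def curve_def sum_negf[symmetric]
      using assms(3) by (intro sum.cong) auto
    finally show ?thesis using poly_altdef_le[OF assms(4)] by simp
  qed
  then show thesis using that by blast
qed

text \<open>A hyperplane section of the curve is the zero set of a polynomial of degree at most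
  \<open>CARD('d)\<close>; too many zeros kill all its coefficients, and distinct exponents isolate
  the coordinates of \<open>c\<close>. This gives the polytopes full dimension.\<close>

lemma curve_hyperplane_card:
  fixes c :: "real ^ 'd"
  assumes "1 \<le> i" "i \<le> r" "z \<noteq> 0" and T: "finite T" "CARD('d) < card T"
    and on: "\<forall>t\<in>T. c \<bullet> curve \<phi> r z i t = h"
  shows "c = 0"
proof -
  let ?e = "\<lambda>x. curve_exponent CARD('d) r i (\<phi> x)"
  let ?k = "\<lambda>x. if \<phi> x \<le> r \<and> \<phi> x \<noteq> i then z else 1"
  define p where "p = (\<Sum>x\<in>UNIV. monom (c $ x * ?k x) (?e x)) - [:h:]"
  have e: "1 \<le> ?e x" "?e x \<le> CARD('d)" for x
    using bij_betwE[OF bij_exponent[OF assms(1,2)]] by auto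
  have "poly p t = c \<bullet> curve \<phi> r z i t - h" for t
    by (auto simp: p_def poly_sum poly_monom inner_vec_def curve_def mult.assoc intro!: sum.cong)
  then have roots: "T \<subseteq> {t. poly p t = 0}" using on by auto
  have "degree p \<le> CARD('d)" unfolding p_def
    by (intro degree_diff_le degree_sum_le order_trans[OF degree_monom_le e(2)]) auto
  have "p = 0"
  proof (rule ccontr)
    assume "p \<noteq> 0"
    then have "card T \<le> degree p"
      using card_mono[OF poly_roots_finite roots] card_poly_roots_bound[of p] by force
    then show False using T \<open>degree p \<le> _\<close> by linarith
  qed
  have "c $ y = 0" for y
  proof -
    have "0 = coeff p (?e y)" using \<open>p = 0\<close> by simp
    also have "\<dots> = (\<Sum>x\<in>UNIV. if ?e y = ?e x then c $ x * ?k x else 0)"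
      using e(1)[of y] by (auto simp: p_def coeff_sum coeff_pCons split: nat.split intro!: sum.cong)
    also have "\<dots> = (\<Sum>x\<in>UNIV. if y = x then c $ x * ?k x else 0)"
      using bij_betw_imp_inj_on[OF bij_exponent[OF assms(1,2)]]
      by (intro sum.cong if_cong) (auto simp: inj_on_def)
    also have "\<dots> = c $ y * ?k y" by simp
    finally show ?thesis using assms(3) by (auto split: if_splits)
  qed
  then show ?thesis by (simp add: vec_eq_iff)
qed

lemma curve_inj: "1 \<le> i \<Longrightarrow> i \<le> r \<Longrightarrow> z \<noteq> 0 \<Longrightarrow> inj (curve \<phi> r z i)"
proof (rule injI)
  fix s t assume asm: "1 \<le> i" "i \<le> r" "z \<noteq> 0" and eq: "curve \<phi> r z i s = curve \<phi> r z i t"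
  \<comment> \<open>The parameter itself is an affine function of the point on the curve.\<close>
  have "degree [:0, 1 :: real:] \<le> CARD('d)" using r by simp
  then obtain c :: "real ^ 'd" and h where ch: "\<And>t. poly [:0, 1:] t = h - c \<bullet> curve \<phi> r z i t"
    using curve_functional_of_poly[OF asm] by metis
  have "s = poly [:0, 1:] s" by simp
  also have "\<dots> = poly [:0, 1:] t" unfolding ch eq ..
  finally show "s = t" by simp
qed

text \<open>The Cayley embedding: a functional \<open>(c, h)\<close> pairs with the point of parameter \<open>t\<close> on the
  \<open>i\<close>-th curve to \<open>h\<^sub>i - c \<bullet> curve \<phi> r z i t\<close>, so it bounds all the polytopes simultaneously.\<close>

definition cayley :: "real \<Rightarrow> nat \<times> real \<Rightarrow> (real ^ 'd) \<times> (real ^ 'd)" where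
  "cayley z = (\<lambda>(i, t). (- curve \<phi> r z i t, axis (\<psi> i) 1))"

lemma inner_cayley: "(c, h) \<bullet> cayley z (i, t) = h $ \<psi> i - c \<bullet> curve \<phi> r z i t"
  by (simp add: cayley_def inner_axis)

lemma tendsto_cayley: "((\<lambda>z. cayley z a) \<longlongrightarrow> cayley 0 a) (at_right 0)"
proof -
  obtain i t where a: "a = (i, t)" by (cases a)
  have "((\<lambda>z. curve \<phi> r z i t) \<longlongrightarrow> curve \<phi> r 0 i t) (at_right 0)"
    unfolding curve_def by (intro tendsto_vec_lambda tendsto_intros) (auto intro: tendsto_eq_intros)
  then show ?thesis unfolding a cayley_def by (auto intro!: tendsto_intros)
qed

text \<open>At \<open>z = 0\<close> a coordinate numbered at most \<open>r\<close> survives only on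
  the curve with that number, so the slopes \<open>b i\<close> are independent of each other. The
  heights supply \<open>a i\<close>, and the coordinates beyond \<open>r\<close> supply the common
  \<open>q\<close>.\<close>

lemma cayley_zero_functional:
  fixes q :: "real poly"
  assumes "degree q \<le> CARD('d) - r + 1" "coeff q 0 = 0" "coeff q 1 = 0"
  obtains u where "\<And>i t. 1 \<le> i \<Longrightarrow> i \<le> r \<Longrightarrow> u \<bullet> cayley 0 (i, t) = poly (q + [:a i, b i:]) t"
proof -
  let ?d = "CARD('d)"
  define c :: "real ^ 'd" where "c = (\<chi> x. if \<phi> x \<le> r then - b (\<phi> x) else - coeff q (\<phi> x - r + 1))"
  define h :: "real ^ 'd" where "h = (\<chi> x. a (\<phi> x))"
  have "(c, h) \<bullet> cayley 0 (i, t) = poly (q + [:a i, b i:]) t" if i: "1 \<le> i" "i \<le> r" for i t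
  proof -
    let ?G = "\<lambda>p. if p \<le> r then (if p = i then b i * t else 0) else coeff q (p - r + 1) * t ^ (p - r + 1)"
    have "- (c \<bullet> curve \<phi> r 0 i t) = (\<Sum>x\<in>UNIV. ?G (\<phi> x))"
      unfolding inner_vec_def c_def curve_def sum_negf[symmetric]
      using i by (intro sum.cong) (auto simp: curve_exponent_def)
    also have "\<dots> = sum ?G {1..?d}" by (rule sum.reindex_bij_betw[OF bij])
    also have "{1..?d} = {1..r} \<union> {r + 1..?d}" using r by auto
    also have "sum ?G \<dots> = sum ?G {1..r} + sum ?G {r + 1..?d}" by (rule sum.union_disjoint) auto
    also have "sum ?G {1..r} = (\<Sum>p\<in>{1..r}. if p = i then b i * t else 0)"
      by (rule sum.cong) auto
    also have "\<dots> = b i * t" using i by simp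
    also have "sum ?G {r + 1..?d} = (\<Sum>j\<in>{2..?d - r + 1}. coeff q j * t ^ j)"
      by (rule sum.reindex_bij_witness[of _ "\<lambda>j. j + r - 1" "\<lambda>p. p - r + 1"]) (use r in auto)
    also have "\<dots> = (\<Sum>j\<in>{1..?d - r + 1}. coeff q j * t ^ j)"
      using assms(3) by (intro sum.mono_neutral_left) (auto simp: not_le less_Suc_eq numeral_2_eq_2)
    also have "\<dots> = poly q t" using poly_altdef_le[OF assms(1)] assms(2) by simp
    finally show ?thesis using i by (simp add: inner_cayley h_def \<psi>_inverse mult.commute)
  qed
  then show thesis using that by blast
qed

text \<open>Interpolation at \<open>m\<close> points in total takes degree
  \<open>2 * m + 2 - 2 * r\<close>, while functionals at \<open>z = 0\<close> realise a common
  \<open>q\<close> of degree up to \<open>CARD('d) - r + 1\<close>. The bound on the total is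
  exactly this comparison.\<close>

lemma cayley_zero_exposed:
  assumes J: "\<forall>i\<in>{1..r}. is_interval (J i)" "disjoint_family_on J {1..r}"
    and S: "\<forall>i\<in>{1..r}. finite (S i) \<and> S i \<noteq> {} \<and> S i \<subseteq> J i"
    and le: "2 * (\<Sum>i\<in>{1..r}. card (S i)) \<le> CARD('d) + r - 1"
  obtains u where "\<forall>i\<in>{1..r}. \<forall>t\<in>J i. (t \<in> S i \<longrightarrow> u \<bullet> cayley 0 (i, t) = 0) \<and>
      (t \<notin> S i \<longrightarrow> u \<bullet> cayley 0 (i, t) > 0)"
proof -
  let ?m = "\<Sum>i\<in>{1..r}. card (S i)"
  have "r \<le> ?m"
    using sum_mono[of "{1..r}" "\<lambda>_. 1" "\<lambda>i. card (S i)"] S by (simp add: Suc_leI card_gt_0_iff)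
  then have D: "(2 * ?m + 2 - 2 * r) + 2 * card {1..r} = 2 * ?m + 2" by simp
  obtain q a b where q: "degree q \<le> 2 * ?m + 2 - 2 * r" "coeff q 0 = 0" "coeff q 1 = 0"
    and pos: "\<forall>i\<in>{1..r}. \<forall>t\<in>J i. (t \<in> S i \<longrightarrow> poly (q + [:a i, b i:]) t = 0) \<and>
      (t \<notin> S i \<longrightarrow> poly (q + [:a i, b i:]) t > 0)"
    by (rule interpolation_family_pos[OF _ _ S J D]) (use r in auto)
  have "degree q \<le> CARD('d) - r + 1" using q(1) le r \<open>r \<le> ?m\<close> by linarith
  then obtain u where "\<And>i t. 1 \<le> i \<Longrightarrow> i \<le> r \<Longrightarrow> u \<bullet> cayley 0 (i, t) = poly (q + [:a i, b i:]) t"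
    using cayley_zero_functional[where q = q and a = a and b = b] q(2,3) by metis
  then show thesis using that[of u] pos by simp
qed

text \<open>A functional exposing the tuple without \<open>t\<close> vanishes at all other points
  and is positive at \<open>t\<close>. If \<open>t\<close> is alone in \<open>S i\<close>, the
  removal would leave an empty set, and the height coordinate of \<open>i\<close> serves instead.
  This is the independence that the perturbation requires.\<close>

lemma cayley_zero_dual:
  assumes J: "\<forall>i\<in>{1..r}. is_interval (J i)" "disjoint_family_on J {1..r}"
    and S: "\<forall>i\<in>{1..r}. finite (S i) \<and> S i \<noteq> {} \<and> S i \<subseteq> J i"
    and le: "2 * (\<Sum>i\<in>{1..r}. card (S i)) \<le> CARD('d) + r - 1"
    and i: "i \<in> {1..r}" and t: "t \<in> S i"
  shows "\<exists>e. e \<bullet> cayley 0 (i, t) \<noteq> 0 \<and> (\<forall>s\<in>(SIGMA i:{1..r}. S i) - {(i, t)}. e \<bullet> cayley 0 s = 0)"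
proof (cases "S i = {t}")
  case True
  let ?e = "(0, axis (\<psi> i) 1) :: (real ^ 'd) \<times> (real ^ 'd)"
  have e: "?e \<bullet> cayley 0 (j, s) = (if j = i then 1 else 0)" if "j \<in> {1..r}" for j s
    using \<psi>_inverse[of i] \<psi>_inverse[of j] that i by (auto simp: inner_cayley axis_def)
  have "?e \<bullet> cayley 0 s = 0" if s: "s \<in> (SIGMA i:{1..r}. S i) - {(i, t)}" for s
  proof -
    obtain j x where jx: "s = (j, x)" "j \<in> {1..r}" "x \<in> S j" using s by auto
    then have "j \<noteq> i" using s True by auto
    then show ?thesis using e[OF jx(2), of x] jx(1) by simp
  qed
  moreover have "?e \<bullet> cayley 0 (i, t) \<noteq> 0" using e[OF i] by simp
  ultimately show ?thesis by blast
next
  case False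
  define S' where "S' = S(i := S i - {t})"
  have S': "\<forall>j\<in>{1..r}. finite (S' j) \<and> S' j \<noteq> {} \<and> S' j \<subseteq> J j"
    using S False t i by (auto simp: S'_def)
  have "(\<Sum>j\<in>{1..r}. card (S' j)) \<le> (\<Sum>j\<in>{1..r}. card (S j))"
    by (rule sum_mono) (use S in \<open>auto simp: S'_def intro: card_mono\<close>)
  then have "2 * (\<Sum>i\<in>{1..r}. card (S' i)) \<le> CARD('d) + r - 1" using le by linarith
  then obtain u where u: "\<forall>j\<in>{1..r}. \<forall>t\<in>J j. (t \<in> S' j \<longrightarrow> u \<bullet> cayley 0 (j, t) = 0) \<and>
      (t \<notin> S' j \<longrightarrow> u \<bullet> cayley 0 (j, t) > 0)"
    using cayley_zero_exposed[OF J S'] by metis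
  have "t \<in> J i" "t \<notin> S' i" using S i t by (auto simp: S'_def)
  then have "u \<bullet> cayley 0 (i, t) > 0" using u i by simp
  moreover have "u \<bullet> cayley 0 s = 0" if s: "s \<in> (SIGMA i:{1..r}. S i) - {(i, t)}" for s
  proof -
    obtain j x where jx: "s = (j, x)" "j \<in> {1..r}" "x \<in> S j" using s by auto
    then have "x \<in> S' j" using s by (auto simp: S'_def)
    moreover have "x \<in> J j" using jx S by auto
    ultimately show ?thesis using u jx by simp
  qed
  ultimately show ?thesis by (intro exI[of _ u]) auto
qed

text \<open>Exposure at \<open>z = 0\<close> passes to small positive \<open>z\<close> by
  perturbation in the Cayley space; the heights of the perturbed functional become the separate
  bounds \<open>h i\<close>.\<close>

lemma eventually_cayley_exposed:
  assumes J: "\<forall>i\<in>{1..r}. is_interval (J i)" "disjoint_family_on J {1..r}"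
    and T: "\<forall>i\<in>{1..r}. finite (T i) \<and> T i \<subseteq> J i"
    and S: "\<forall>i\<in>{1..r}. S i \<noteq> {} \<and> S i \<subseteq> T i"
    and le: "2 * (\<Sum>i\<in>{1..r}. card (S i)) \<le> CARD('d) + r - 1"
  shows "\<forall>\<^sub>F z in at_right 0. \<exists>c h. \<forall>i\<in>{1..r}. \<forall>t\<in>T i.
    c \<bullet> curve \<phi> r z i t \<le> h i \<and> (c \<bullet> curve \<phi> r z i t = h i \<longleftrightarrow> t \<in> S i)"
proof -
  have S': "\<forall>i\<in>{1..r}. finite (S i) \<and> S i \<noteq> {} \<and> S i \<subseteq> J i"
    using S T finite_subset by (meson subset_trans)
  obtain u where u: "\<forall>j\<in>{1..r}. \<forall>t\<in>J j. (t \<in> S j \<longrightarrow> u \<bullet> cayley 0 (j, t) = 0) \<and>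
      (t \<notin> S j \<longrightarrow> u \<bullet> cayley 0 (j, t) > 0)"
    using cayley_zero_exposed[OF J S' le] by metis
  let ?A = "SIGMA i:{1..r}. T i" and ?S = "SIGMA i:{1..r}. S i"
  have "\<forall>\<^sub>F z in at_right 0. \<exists>c. (\<forall>s\<in>?S. c \<bullet> cayley z s = 0) \<and> (\<forall>s\<in>?A - ?S. c \<bullet> cayley z s > 0)"
  proof (rule perturbed_supporting_functional)
    show "finite ?A" using T by auto
    show "?S \<subseteq> ?A" using S by auto
    show "\<forall>s\<in>?A. ((\<lambda>z. cayley z s) \<longlongrightarrow> cayley 0 s) (at_right 0)" using tendsto_cayley by blast
    show "\<forall>a\<in>?S. \<exists>e. e \<bullet> cayley 0 a \<noteq> 0 \<and> (\<forall>s\<in>?S - {a}. e \<bullet> cayley 0 s = 0)"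
      using cayley_zero_dual[OF J S' le] by auto
    show "\<forall>s\<in>?S. u \<bullet> cayley 0 s = 0" using u S' by auto
    show "\<forall>s\<in>?A - ?S. u \<bullet> cayley 0 s > 0" using u T by auto
  qed
  then show ?thesis
  proof eventually_elim
    case (elim z)
    then obtain w where w: "\<forall>s\<in>?S. w \<bullet> cayley z s = 0" "\<forall>s\<in>?A - ?S. w \<bullet> cayley z s > 0" by blast
    obtain c h where ch: "w = (c, h)" by (cases w)
    have "c \<bullet> curve \<phi> r z i t \<le> h $ \<psi> i \<and> (c \<bullet> curve \<phi> r z i t = h $ \<psi> i \<longleftrightarrow> t \<in> S i)"
      if "i \<in> {1..r}" "t \<in> T i" for i t
    proof (cases "t \<in> S i")
      case True
      then have "(i, t) \<in> ?S" using that by auto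
      then have "w \<bullet> cayley z (i, t) = 0" using w(1) by blast
      then show ?thesis using True unfolding ch inner_cayley by simp
    next
      case False
      then have "(i, t) \<in> ?A - ?S" using that by auto
      then have "w \<bullet> cayley z (i, t) > 0" using w(2) by blast
      then show ?thesis using False unfolding ch inner_cayley by simp
    qed
    then show ?case by (intro exI[of _ c] exI[of _ "\<lambda>i. h $ \<psi> i"]) blast
  qed
qed

text \<open>The product of the squares \<open>(t - s)\<^sup>2\<close> is nonnegative, vanishes
  exactly on \<open>S\<close> and has degree at most \<open>CARD('d)\<close>, so it is the slack of
  a supporting functional.\<close>

lemma curve_subset_exposed:
  assumes "1 \<le> i" "i \<le> r" "z \<noteq> 0" "finite S" "2 * card S \<le> CARD('d)"
  obtains c h where "\<And>t. c \<bullet> curve \<phi> r z i t \<le> h \<and> (c \<bullet> curve \<phi> r z i t = h \<longleftrightarrow> t \<in> S)"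
proof -
  let ?p = "\<Prod>s\<in>S. [:-s, 1:]\<^sup>2 :: real poly"
  have "degree ?p \<le> (\<Sum>s\<in>S. degree ([:-s, 1:]\<^sup>2 :: real poly))"
    using degree_prod_sum_le[OF assms(4), of "\<lambda>s. [:-s, 1:]\<^sup>2 :: real poly"] by (simp add: comp_def)
  also have "\<dots> \<le> (\<Sum>s\<in>S. 2)"
    by (rule sum_mono) (rule order_trans[OF degree_power_le], simp)
  finally have "degree ?p \<le> CARD('d)" using assms(5) by simp
  then obtain c h where ch: "\<And>t. poly ?p t = h - c \<bullet> curve \<phi> r z i t"
    using curve_functional_of_poly[OF assms(1-3)] by metis
  have val: "poly ?p t = (\<Prod>s\<in>S. (t - s)\<^sup>2)" for t
    by (simp add: poly_prod poly_power)
  have "h - c \<bullet> curve \<phi> r z i t \<ge> 0" for t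
    unfolding ch[symmetric] val by (rule prod_nonneg) simp
  moreover have "h - c \<bullet> curve \<phi> r z i t = 0 \<longleftrightarrow> t \<in> S" for t
    unfolding ch[symmetric] val using assms(4) by auto
  ultimately show thesis using that[of c h] by (smt (verit))
qed

lemma cyclic_polytope:
  assumes i: "1 \<le> i" "i \<le> r" and z: "z \<noteq> 0" and T: "finite T" "CARD('d) < card T" and d: "2 \<le> CARD('d)"
  shows "neighborly_polytope CARD('d) (convex hull (curve \<phi> r z i ` T))"
    and "card (vertices (convex hull (curve \<phi> r z i ` T))) = card T"
proof -
  let ?V = "curve \<phi> r z i ` T"
  let ?P = "convex hull ?V"
  have inj: "inj (curve \<phi> r z i)" using curve_inj i z by blast
  have face: "convex hull V face_of ?P" if V: "V \<subseteq> ?V" "card V \<le> CARD('d) div 2" for V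
  proof -
    define S where "S = curve \<phi> r z i -` V"
    have VS: "V = curve \<phi> r z i ` S" using V(1) by (auto simp: S_def)
    have "S \<subseteq> T" using V(1) inj by (auto simp: S_def dest: injD)
    then have "finite S" using T finite_subset by blast
    moreover have "card V = card S" unfolding VS by (rule card_image) (rule inj_on_subset[OF inj], simp)
    ultimately have "finite S" "2 * card S \<le> CARD('d)" using V(2) by auto
    then obtain c h where ch: "\<And>t. c \<bullet> curve \<phi> r z i t \<le> h \<and> (c \<bullet> curve \<phi> r z i t = h \<longleftrightarrow> t \<in> S)"
      using curve_subset_exposed[OF i z] by metis
    have "?P \<inter> {x. c \<bullet> x = h} = convex hull V"
      by (rule convex_hull_max_face) (use T ch V in \<open>auto simp: S_def\<close>)
    moreover have "?P \<inter> {x. c \<bullet> x = h} face_of ?P"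
    proof (rule face_of_Int_supporting_hyperplane_le)
      show "c \<bullet> x \<le> h" if "x \<in> ?P" for x
        by (rule convex_hull_inner_le[OF _ that]) (use ch in auto)
    qed simp
    ultimately show ?thesis by simp
  qed
  have vert: "vertices ?P = ?V"
  proof
    show "vertices ?P \<subseteq> ?V" unfolding vertices_def using extreme_point_of_convex_hull by auto
    show "?V \<subseteq> vertices ?P"
    proof
      fix v assume "v \<in> ?V"
      \<comment> \<open>\<open>CARD('d) \<ge> 2\<close> makes singletons small enough for
        \<open>face\<close>.\<close>
      then have "convex hull {v} face_of ?P" using d by (intro face) auto
      then show "v \<in> vertices ?P" by (simp add: vertices_def face_of_singleton)
    qed
  qed
  show "card (vertices ?P) = card T"
    unfolding vert by (rule card_image) (rule inj_on_subset[OF inj], simp)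
  have "m_neighborly (CARD('d) div 2) ?P"
    unfolding m_neighborly_def vert
  proof (intro allI impI)
    fix V assume V: "V \<subseteq> ?V \<and> card V \<le> CARD('d) div 2"
    have "vertices (convex hull V) = V"
    proof
      show "vertices (convex hull V) \<subseteq> V" unfolding vertices_def using extreme_point_of_convex_hull by auto
      show "V \<subseteq> vertices (convex hull V)"
      proof
        fix v assume "v \<in> V"
        then have "v \<in> vertices ?P" "v \<in> convex hull V" using V vert by (auto intro: hull_inc)
        then show "v \<in> vertices (convex hull V)"
          using extreme_point_of_face[OF face, of V v] V by (simp add: vertices_def)
      qed
    qed
    then show "\<exists>F. F face_of ?P \<and> vertices F = V" using face V by blast
  qed
  moreover have "polytope ?P" using T unfolding polytope_def by blast
  moreover have "aff_dim ?P = int CARD('d)"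
  proof (rule ccontr)
    assume "aff_dim ?P \<noteq> int CARD('d)"
    then have "aff_dim ?P < DIM(real ^ 'd)" using aff_dim_le_DIM[of ?P] by simp
    then obtain c h where "c \<noteq> 0" "?P \<subseteq> {x. c \<bullet> x = h}"
      using aff_lowdim_subset_hyperplane by blast
    then have "\<forall>t\<in>T. c \<bullet> curve \<phi> r z i t = h" by (blast intro: hull_inc)
    then show False using curve_hyperplane_card[OF i z T] \<open>c \<noteq> 0\<close> by blast
  qed
  ultimately show "neighborly_polytope CARD('d) ?P"
    by (simp add: neighborly_polytope_def d_polytope_def)
qed

end

section \<open>Choice of parameters and of one perturbation for all tuples\<close>

theorem theorem6:
  fixes r :: nat and n :: "nat \<Rightarrow> nat"
  assumes "3 \<le> CARD('d::finite)"
    and "2 \<le> r" and "r \<le> CARD('d) - 1"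
    and "\<And>i. i \<in> {1..r} \<Longrightarrow> CARD('d) + 1 \<le> n i"
  shows "\<exists>P :: nat \<Rightarrow> (real ^ 'd) set.
    (\<forall>i\<in>{1..r}. neighborly_polytope CARD('d) (P i) \<and> card (vertices (P i)) = n i) \<and>
    (\<forall>k::nat. int k \<le> \<lfloor>real (CARD('d) + r - 1) / 2\<rfloor> - int r \<longrightarrow>
       f_num k (\<Sum>i\<in>{1..r}. P i) =
         (\<Sum>s \<in> {s \<in> (\<Pi>\<^sub>E i\<in>{1..r}. {1..n i}). (\<Sum>i\<in>{1..r}. s i) = k + r}.
            \<Prod>i\<in>{1..r}. n i choose s i))"
proof -
  let ?I = "{1..r}" and ?M = "(CARD('d) + r - 1) div 2"
  obtain \<phi> :: "'d \<Rightarrow> nat" where "bij_betw \<phi> UNIV {1..CARD('d)}"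
    using finite_same_card_bij[of "UNIV :: 'd set" "{1..CARD('d)}"] by auto
  then interpret curve_family \<phi> r
    using assms by unfold_locales auto
  \<comment> \<open>Half-open unit intervals are disjoint, and the distinct fractions
    \<open>1 / (real j + 2)\<close> place \<open>n i\<close> parameters in the \<open>i\<close>-th
    one.\<close>
  define J :: "nat \<Rightarrow> real set" where "J = (\<lambda>i. {real i..<real i + 1})"
  define T where "T = (\<lambda>i. (\<lambda>j. real i + 1 / (real j + 2)) ` {..<n i})"
  have J: "\<forall>i\<in>?I. is_interval (J i)" "disjoint_family_on J ?I"
    by (auto simp: J_def is_interval_co disjoint_family_on_def)
  have T: "\<forall>i\<in>?I. finite (T i) \<and> T i \<subseteq> J i"
    by (auto simp: T_def J_def)
  have cardT: "card (T i) = n i" for i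
    unfolding T_def by (subst card_image) (auto simp: inj_on_def)
  \<comment> \<open>Only finitely many tuples of parameter sets have to be exposed, so a single
    small \<open>z > 0\<close> works for all of them.\<close>
  let ?X = "{S \<in> (\<Pi>\<^sub>E i\<in>?I. Pow (T i) - {{}}). (\<Sum>i\<in>?I. card (S i)) \<le> ?M}"
  let ?exp = "\<lambda>z S. \<exists>c h. \<forall>i\<in>?I. \<forall>t\<in>T i.
    c \<bullet> curve \<phi> r z i t \<le> h i \<and> (c \<bullet> curve \<phi> r z i t = h i \<longleftrightarrow> t \<in> S i)"
  have "finite (\<Pi>\<^sub>E i\<in>?I. Pow (T i) - {{}})" using T by (intro finite_PiE) auto
  then have "finite ?X" by simp
  moreover have "\<forall>\<^sub>F z in at_right 0. ?exp z S" if S: "S \<in> ?X" for S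
  proof (rule eventually_cayley_exposed[OF J T])
    show "\<forall>i\<in>?I. S i \<noteq> {} \<and> S i \<subseteq> T i" using S by (auto simp: PiE_def Pi_def)
    have "(\<Sum>i\<in>?I. card (S i)) \<le> ?M" using S by simp
    then show "2 * (\<Sum>i\<in>?I. card (S i)) \<le> CARD('d) + r - 1" by linarith
  qed
  ultimately have "\<forall>\<^sub>F z in at_right 0. \<forall>S\<in>?X. ?exp z S"
    by (intro eventually_ball_finite) auto
  moreover have "\<forall>\<^sub>F z in at_right 0. z > (0 :: real)" by (rule eventually_at_right_less)
  ultimately have "\<forall>\<^sub>F z in at_right 0. (\<forall>S\<in>?X. ?exp z S) \<and> z > 0" by (rule eventually_conj)
  then have "\<exists>z. (\<forall>S\<in>?X. ?exp z S) \<and> z > 0" by (rule eventually_happens'[rotated]) simp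
  then obtain z where z: "\<forall>S\<in>?X. ?exp z S" "z > 0" by (elim exE conjE)
  define V where "V = (\<lambda>i. curve \<phi> r z i ` T i)"
  have inj: "inj (curve \<phi> r z i)" if "i \<in> ?I" for i using curve_inj[of i z] that z by simp
  have finV: "\<forall>i\<in>?I. finite (V i)" using T by (auto simp: V_def)
  have cardV: "card (V i) = n i" if "i \<in> ?I" for i
    unfolding V_def cardT[of i, symmetric] by (rule card_image) (rule inj_on_subset[OF inj[OF that]], simp)
  have exposed: "\<exists>c. exposes c ?I V S"
    if S: "\<forall>i\<in>?I. S i \<noteq> {} \<and> S i \<subseteq> V i" and le: "(\<Sum>i\<in>?I. card (S i)) \<le> ?M" for S
  proof -
    \<comment> \<open>Vertex sets are pulled back along the injective curves to parameter sets of
      equal size; restricting to \<open>?I\<close> makes the tuple a member of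
      \<open>?X\<close>.\<close>
    define S' where "S' = (\<lambda>i\<in>?I. {t \<in> T i. curve \<phi> r z i t \<in> S i})"
    have img: "S i = curve \<phi> r z i ` S' i" if "i \<in> ?I" for i
    proof -
      have "S i \<subseteq> curve \<phi> r z i ` T i" using S that unfolding V_def by blast
      then show ?thesis using that by (auto simp: S'_def)
    qed
    have "card (S i) = card (S' i)" if "i \<in> ?I" for i
      unfolding img[OF that] by (rule card_image) (rule inj_on_subset[OF inj[OF that]], simp)
    then have "(\<Sum>i\<in>?I. card (S' i)) \<le> ?M" using le by simp
    moreover have "S' i \<noteq> {}" if "i \<in> ?I" for i using img[OF that] S that by auto
    then have "S' \<in> (\<Pi>\<^sub>E i\<in>?I. Pow (T i) - {{}})" by (auto simp: S'_def)
    ultimately have "S' \<in> ?X" by blast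
    with z(1) have "?exp z S'" by (rule bspec)
    then obtain c h where ch: "\<forall>i\<in>?I. \<forall>t\<in>T i.
      c \<bullet> curve \<phi> r z i t \<le> h i \<and> (c \<bullet> curve \<phi> r z i t = h i \<longleftrightarrow> t \<in> S' i)" by (elim exE)
    have "exposes c ?I V S" unfolding exposes_def
    proof (intro exI[of _ h] ballI)
      fix i v assume i: "i \<in> ?I" and "v \<in> V i"
      then obtain t where t: "t \<in> T i" "v = curve \<phi> r z i t" by (auto simp: V_def)
      then have "t \<in> S' i \<longleftrightarrow> v \<in> S i" using i by (simp add: S'_def)
      then show "c \<bullet> v \<le> h i \<and> (c \<bullet> v = h i \<longleftrightarrow> v \<in> S i)" using ch i t by blast
    qed
    then show ?thesis by blast
  qed
  show ?thesis
  proof (intro exI[of _ "\<lambda>i. convex hull V i"] conjI ballI allI impI)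
    fix i assume i: "i \<in> ?I"
    then have "CARD('d) < card (T i)" "finite (T i)" using assms(4) T cardT by (auto simp: Suc_le_eq)
    then show "neighborly_polytope CARD('d) (convex hull V i)" "card (vertices (convex hull V i)) = n i"
      using cyclic_polytope[of i z "T i"] i z assms(1) cardT unfolding V_def by auto
  next
    fix k assume "int k \<le> \<lfloor>real (CARD('d) + r - 1) / 2\<rfloor> - int r"
    moreover have "\<lfloor>real (CARD('d) + r - 1) / 2\<rfloor> = int ?M"
      using floor_divide_of_nat_eq[of "CARD('d) + r - 1" 2] by simp
    ultimately have k: "k + card ?I \<le> ?M" by simp
    have "f_num k (\<Sum>i\<in>?I. convex hull V i) =
      card {S \<in> (\<Pi>\<^sub>E i\<in>?I. Pow (V i) - {{}}). (\<Sum>i\<in>?I. card (S i)) = k + card ?I}"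
      by (rule f_num_sum_hulls[OF _ finV exposed k]) auto
    also have "\<dots> = (\<Sum>s \<in> {s \<in> (\<Pi>\<^sub>E i\<in>?I. {1..card (V i)}). (\<Sum>i\<in>?I. s i) = k + card ?I}.
            \<Prod>i\<in>?I. card (V i) choose s i)"
      by (rule card_nonempty_subfamilies[OF _ finV]) simp
    also have "(\<Pi>\<^sub>E i\<in>?I. {1..card (V i)}) = (\<Pi>\<^sub>E i\<in>?I. {1..n i})"
      by (rule PiE_cong) (simp add: cardV)
    finally show "f_num k (\<Sum>i\<in>?I. convex hull V i) =
         (\<Sum>s \<in> {s \<in> (\<Pi>\<^sub>E i\<in>?I. {1..n i}). (\<Sum>i\<in>?I. s i) = k + r}. \<Prod>i\<in>?I. n i choose s i)"
      by (simp add: cardV)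
  qed
qed

end
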